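(* Let $d\in\mathbb{N}$, fix $\alpha\in\left(0,\frac1d\right)$ and $C>0$, and suppose that $1<pn^\alpha<C$ for all sufficiently large $n$. Then for every $\varepsilon>0$ there exists $n_0$ such that for all $n\ge n_0$, $$u_d(n,p)\ge(2-2\alpha-\varepsilon)\frac{\ln n}{p}.$$
   Context: $G(n,p)$ is the Erdős–Rényi random graph on $n$ labelled vertices (vertex set $V$), each edge present independently with probability $p=p(n)$; $\mathbb{P}_{n,p}$ is the corresponding probability. A diameter graph in $\mathbb{R}^d$ is a graph $(V,E)$ with $V\subset\mathbb{R}^d$ finite and $E=\{\{\mathbf{x},\mathbf{y}\}\subseteq V: |\mathbf{x}-\mathbf{y}|=\operatorname{diam}V\}$, where $\operatorname{diam}V=\max_{\mathbf{x},\mathbf{y}\in V}|\mathbf{x}-\mathbf{y}|$ (Euclidean norm); a graph is a diameter graph in $\mathbb{R}^d$ if it is isomorphic to one. $u_d(n,p)$ is the largest positive integer $k$ such that $\mathbb{P}_{n,p}\big(\exists W\subseteq V,\ |W|=k,\ G[W]$ is a diameter graph in $\mathbb{R}^d$ and $\chi(G[W])=d+1\big)>\frac12$, where $G[W]$ is the induced subgraph; if no such $k$ exists, $u_d(n,p)=0$. *)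

theory Defs
  imports "HOL-Analysis.Analysis"
begin

text \<open>Simple graphs are given by a vertex set and a set of edges, each edge a 2-element set.\<close>

definition all_edges :: "nat \<Rightarrow> nat set set" where
  "all_edges n = {e. \<exists>x y. x < n \<and> y < n \<and> x \<noteq> y \<and> e = {x, y}}"

definition prob_Gnp :: "nat \<Rightarrow> real \<Rightarrow> (nat set set \<Rightarrow> bool) \<Rightarrow> real" where
  "prob_Gnp n p Q =
     (\<Sum>E \<in> {E. E \<subseteq> all_edges n \<and> Q E}.
        p ^ card E * (1 - p) ^ (card (all_edges n) - card E))"

definition induced_edges :: "'v set set \<Rightarrow> 'v set \<Rightarrow> 'v set set" where
  "induced_edges E W = {e \<in> E. e \<subseteq> W}"

definition diam_fin :: "('a::metric_space) set \<Rightarrow> real" where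
  "diam_fin V = Max {dist x y | x y. x \<in> V \<and> y \<in> V}"

definition is_diameter_graph :: "'d::finite itself \<Rightarrow> 'v set \<Rightarrow> 'v set set \<Rightarrow> bool" where
  "is_diameter_graph _ W E \<longleftrightarrow> finite W \<and>
     (\<exists>f :: 'v \<Rightarrow> real ^ 'd. inj_on f W \<and>
        (\<forall>x \<in> W. \<forall>y \<in> W. x \<noteq> y \<longrightarrow>
            ({x, y} \<in> E \<longleftrightarrow> dist (f x) (f y) = diam_fin (f ` W))))"

definition chromatic_number :: "'v set \<Rightarrow> 'v set set \<Rightarrow> nat" where
  "chromatic_number W E = (LEAST k. \<exists>c :: 'v \<Rightarrow> nat.
      (\<forall>x \<in> W. c x < k) \<and> (\<forall>x \<in> W. \<forall>y \<in> W. {x, y} \<in> E \<longrightarrow> x \<noteq> y \<longrightarrow> c x \<noteq> c y))"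

definition event_u :: "'d::finite itself \<Rightarrow> nat \<Rightarrow> nat \<Rightarrow> nat set set \<Rightarrow> bool" where
  "event_u D n k E \<longleftrightarrow> (\<exists>W \<subseteq> {..<n}. card W = k \<and>
       is_diameter_graph D W (induced_edges E W) \<and>
       chromatic_number W (induced_edges E W) = CARD('d) + 1)"

definition u_d :: "'d::finite itself \<Rightarrow> nat \<Rightarrow> real \<Rightarrow> nat" where
  "u_d D n p = (let S = {k. 0 < k \<and> prob_Gnp n p (event_u D n k) > 1/2}
                in if S = {} then 0 else Max S)"

end

theory Submission
  imports Defs "HOL-Real_Asymp.Real_Asymp"
begin

text \<open>
  A clique on \<open>d + 1\<close> vertices together with isolated vertices has chromatic number \<open>d + 1\<close> and is a
  diameter graph: put the clique on a regular simplex and the isolated vertices close to the midpoint of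
  an edge of the simplex. So it suffices to find, with probability more than \<open>1/2\<close>, a clique in one half of the
  vertices (possible since \<open>n p\<^sup>d\<close> tends to infinity) and an independent set of size about
  \<open>(2 - 2\<alpha>) ln n / p\<close> in the other half; by Markov's inequality only a vanishing fraction of the
  independent set is adjacent to the clique, and these vertices are discarded. The independent set comes
  from the second moment method, boosted by the bounded difference inequality for vertex exposure when
  \<open>\<alpha>\<close> is large.
\<close>

subsection \<open>Expectations over random subsets\<close>

text \<open>The constant is a first moment threshold: about
  \<open>exp (k * ln (n / k) - p * k^2 / 2)\<close> independent \<open>k\<close>-sets are expected,
  which is large up to \<open>k\<close> near \<open>2 * ln (n * p) / p\<close>, that is
  \<open>(2 - 2 * \<alpha>) * ln n / p\<close>. The condition \<alpha> < 1/d makes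
  \<open>n * p^d\<close>, the order of the number of common neighbours of \<open>d\<close> vertices,
  at least a positive power of \<open>n\<close>. The obstacle is the second moment. Overlaps below a
  cutoff \<open>L = n powr g\<close> cost a factor of about \<open>exp (p * L^2 / 2)\<close>, while
  larger overlaps are controlled when \<open>g > 2 * \<alpha> - 1\<close>. Both are harmless at once
  only for \<alpha> < 2/3. Bounded differences, in turn, need deviations of order
  \<open>n powr \<alpha>\<close> to exceed \<open>sqrt n\<close>, that is \<alpha> > 1/2. The two
  ranges overlap, and the split is made at 3/5; since \<alpha> < 1/d, the second regime concerns
  \<open>d = 1\<close> only. Clique and independent set live on disjoint vertex sets so that the
  edges between them are still unexposed, hence independent of both, when Markov's inequality is
  applied.\<close>

definition bern_expect :: "real \<Rightarrow> 'a set \<Rightarrow> ('a set \<Rightarrow> real) \<Rightarrow> real" where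
  "bern_expect p A f = (\<Sum>S\<in>Pow A. p ^ card S * (1 - p) ^ card (A - S) * f S)"

text \<open>Independence in product form: disjoint sets of coordinates may be exposed one after the
  other. The conditioning arguments further on rest on this finite Fubini identity.\<close>

lemma bern_expect_Un:
  assumes "finite A" "finite B" "A \<inter> B = {}"
  shows "bern_expect p (A \<union> B) f = bern_expect p A (\<lambda>S. bern_expect p B (\<lambda>T. f (S \<union> T)))"
proof -
  have "bern_expect p A (\<lambda>S. bern_expect p B (\<lambda>T. f (S \<union> T))) =
    (\<Sum>(S, T)\<in>Pow A \<times> Pow B. p ^ card S * (1 - p) ^ card (A - S) *
       (p ^ card T * (1 - p) ^ card (B - T) * f (S \<union> T)))"
    using assms by (simp add: bern_expect_def sum_distrib_left sum.cartesian_product)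
  also have "\<dots> = bern_expect p (A \<union> B) f"
    unfolding bern_expect_def
  proof (rule sum.reindex_bij_witness[where i = "\<lambda>R. (R \<inter> A, R \<inter> B)" and j = "\<lambda>(S, T). S \<union> T"])
    fix x assume x: "x \<in> Pow A \<times> Pow B"
    obtain S T where ST: "x = (S, T)" "S \<subseteq> A" "T \<subseteq> B" using x by auto
    have fin: "finite S" "finite T" using ST assms finite_subset by blast+
    have 1: "card (S \<union> T) = card S + card T"
      using ST assms fin by (intro card_Un_disjoint) auto
    have "A \<union> B - (S \<union> T) = (A - S) \<union> (B - T)" using ST assms by blast
    then have 2: "card (A \<union> B - (S \<union> T)) = card (A - S) + card (B - T)"
      using assms by (simp add: card_Un_disjoint disjoint_iff)
    show "(case x of (S, T) \<Rightarrow> S \<union> T) \<in> Pow (A \<union> B)" using ST by auto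
    show "p ^ card (case x of (S, T) \<Rightarrow> S \<union> T) * (1 - p) ^ card (A \<union> B - (case x of (S, T) \<Rightarrow> S \<union> T)) *
         f (case x of (S, T) \<Rightarrow> S \<union> T) =
         (case x of (S, T) \<Rightarrow> p ^ card S * (1 - p) ^ card (A - S) * (p ^ card T * (1 - p) ^ card (B - T) * f (S \<union> T)))"
      using ST(1) 1 2 by (simp add: power_add)
  qed (use assms in auto)
  finally show ?thesis by simp
qed

lemma bern_expect_cong:
  assumes "\<And>S. S \<subseteq> A \<Longrightarrow> f S = g S"
  shows "bern_expect p A f = bern_expect p A g"
  using assms by (simp add: bern_expect_def)

lemma bern_expect_add:
  "bern_expect p A (\<lambda>S. f S + g S) = bern_expect p A f + bern_expect p A g"
  by (simp add: bern_expect_def sum.distrib distrib_left)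

lemma bern_expect_diff:
  "bern_expect p A (\<lambda>S. f S - g S) = bern_expect p A f - bern_expect p A g"
  by (simp add: bern_expect_def sum_subtractf right_diff_distrib)

lemma bern_expect_cmult:
  "bern_expect p A (\<lambda>S. c * f S) = c * bern_expect p A f"
  unfolding bern_expect_def sum_distrib_left by (intro sum.cong) (auto simp: mult_ac)

lemma bern_expect_cmult_right:
  "bern_expect p A (\<lambda>S. f S * c) = bern_expect p A f * c"
  unfolding bern_expect_def sum_distrib_right by (intro sum.cong) (auto simp: mult_ac)

lemma bern_expect_sum:
  "bern_expect p A (\<lambda>S. \<Sum>i\<in>I. f i S) = (\<Sum>i\<in>I. bern_expect p A (f i))"
  unfolding bern_expect_def sum_distrib_left by (rule sum.swap)

lemma bern_expect_singleton: "bern_expect p {a} f = p * f {a} + (1 - p) * f {}"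
  by (simp add: bern_expect_def Pow_insert)

lemma bern_expect_empty [simp]: "bern_expect p {} f = f {}"
  by (simp add: bern_expect_def)

lemma bern_expect_const [simp]:
  assumes "finite A"
  shows "bern_expect p A (\<lambda>_. c) = c"
  using assms
proof (induction A rule: finite_induct)
  case (insert a A)
  then have "bern_expect p ({a} \<union> A) (\<lambda>_. c) = c"
    by (subst bern_expect_Un) (auto simp: bern_expect_singleton algebra_simps)
  then show ?case by simp
qed simp

lemma bern_expect_mono:
  assumes "0 \<le> p" "p \<le> 1" "\<And>S. S \<subseteq> A \<Longrightarrow> f S \<le> g S"
  shows "bern_expect p A f \<le> bern_expect p A g"
  unfolding bern_expect_def using assms by (intro sum_mono mult_left_mono) auto

lemma bern_expect_le_const:
  assumes "0 \<le> p" "p \<le> 1" "finite A" "\<And>S. S \<subseteq> A \<Longrightarrow> f S \<le> c"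
  shows "bern_expect p A f \<le> c"
  using bern_expect_mono[of p A f "\<lambda>_. c"] assms by simp

lemma bern_expect_ge_const:
  assumes "0 \<le> p" "p \<le> 1" "finite A" "\<And>S. S \<subseteq> A \<Longrightarrow> c \<le> f S"
  shows "c \<le> bern_expect p A f"
  using bern_expect_mono[of p A "\<lambda>_. c" f] assms by simp

text \<open>The coordinates outside \<open>B\<close> average out with total weight 1.\<close>

lemma bern_expect_subset:
  assumes "finite A" "B \<subseteq> A"
  shows "bern_expect p A (\<lambda>S. f (S \<inter> B)) = bern_expect p B f"
proof -
  have "bern_expect p (B \<union> (A - B)) (\<lambda>S. f (S \<inter> B)) =
      bern_expect p B (\<lambda>S. bern_expect p (A - B) (\<lambda>T. f ((S \<union> T) \<inter> B)))"
    using assms finite_subset by (subst bern_expect_Un) auto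
  also have "\<dots> = bern_expect p B (\<lambda>S. bern_expect p (A - B) (\<lambda>T. f S))"
    by (intro bern_expect_cong arg_cong[where f = f]) auto
  also have "\<dots> = bern_expect p B f" using assms by simp
  finally show ?thesis using assms by (simp add: Un_absorb1)
qed

lemma bern_expect_supset:
  assumes "finite A" "T \<subseteq> A"
  shows "bern_expect p A (\<lambda>S. of_bool (T \<subseteq> S)) = p ^ card T"
proof -
  have "bern_expect p A (\<lambda>S. of_bool (T \<subseteq> S)) = bern_expect p A (\<lambda>S. of_bool (S \<inter> T = T))"
    by (intro bern_expect_cong) (auto intro!: arg_cong[where f = of_bool])
  also have "\<dots> = bern_expect p T (\<lambda>S. of_bool (S = T))"
    by (rule bern_expect_subset[OF assms, where f = "\<lambda>S. of_bool (S = T)"])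
  also have "\<dots> = (\<Sum>S\<in>Pow T. if S = T then p ^ card T else 0)"
    unfolding bern_expect_def by (intro sum.cong) auto
  also have "\<dots> = p ^ card T" using assms finite_subset by (subst sum.delta) auto
  finally show ?thesis .
qed

lemma bern_expect_disjoint:
  assumes "finite A" "T \<subseteq> A"
  shows "bern_expect p A (\<lambda>S. of_bool (T \<inter> S = {})) = (1 - p) ^ card T"
proof -
  have "bern_expect p A (\<lambda>S. of_bool (T \<inter> S = {})) = bern_expect p A (\<lambda>S. of_bool (S \<inter> T = {}))"
    by (simp add: Int_commute)
  also have "\<dots> = bern_expect p T (\<lambda>S. of_bool (S = {}))"
    by (rule bern_expect_subset[OF assms, where f = "\<lambda>S. of_bool (S = {})"])
  also have "\<dots> = (\<Sum>S\<in>Pow T. if S = {} then (1 - p) ^ card T else 0)"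
    unfolding bern_expect_def by (intro sum.cong) auto
  also have "\<dots> = (1 - p) ^ card T" using assms finite_subset by (subst sum.delta) auto
  finally show ?thesis .
qed

lemma bern_expect_card_Int:
  assumes "finite A" "T \<subseteq> A"
  shows "bern_expect p A (\<lambda>S. real (card (T \<inter> S))) = p * real (card T)"
proof -
  have fT: "finite T" using assms finite_subset by blast
  have "bern_expect p A (\<lambda>S. real (card (T \<inter> S))) =
      bern_expect p A (\<lambda>S. \<Sum>x\<in>T. of_bool ({x} \<subseteq> S))"
  proof (intro bern_expect_cong)
    fix S
    have "(\<Sum>x\<in>T. of_bool ({x} \<subseteq> S) :: real) = real (card {x \<in> T. x \<in> S})"
      using fT by (simp add: of_bool_def sum.If_cases Collect_conj_eq)
    also have "{x \<in> T. x \<in> S} = T \<inter> S" by auto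
    finally show "real (card (T \<inter> S)) = (\<Sum>x\<in>T. of_bool ({x} \<subseteq> S))" by simp
  qed
  also have "\<dots> = (\<Sum>x\<in>T. bern_expect p A (\<lambda>S. of_bool ({x} \<subseteq> S)))"
    by (rule bern_expect_sum)
  also have "\<dots> = (\<Sum>x\<in>T. p)"
    using assms by (intro sum.cong refl) (subst bern_expect_supset, auto)
  finally show ?thesis by (simp add: mult.commute)
qed

lemma bern_expect_compl:
  assumes "finite A"
  shows "bern_expect p A (\<lambda>S. of_bool (\<not> Q S)) = 1 - bern_expect p A (\<lambda>S. of_bool (Q S))"
proof -
  have "bern_expect p A (\<lambda>S. of_bool (\<not> Q S)) = bern_expect p A (\<lambda>S. 1 - of_bool (Q S))"
    by (intro bern_expect_cong) auto
  then show ?thesis using assms by (simp add: bern_expect_diff)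
qed

text \<open>Cauchy-Schwarz for \<open>f\<close> times the indicator of \<open>Q\<close>. Unlike
  Chebyshev's inequality, it still bounds the probability of \<open>Q\<close> from below when the
  second moment of \<open>f\<close> is far larger than the squared mean, which has to be allowed for
  large \<alpha>.\<close>

lemma bern_expect_Cauchy_Schwarz:
  assumes "0 \<le> p" "p \<le> 1" "\<And>S. S \<subseteq> A \<Longrightarrow> \<not> Q S \<Longrightarrow> f S = 0"
  shows "(bern_expect p A f)\<^sup>2 \<le> bern_expect p A (\<lambda>S. of_bool (Q S)) * bern_expect p A (\<lambda>S. (f S)\<^sup>2)"
proof -
  define w where "w S = p ^ card S * (1 - p) ^ card (A - S)" for S
  have w0: "w S \<ge> 0" for S using assms by (simp add: w_def)
  have "bern_expect p A f = (\<Sum>S\<in>Pow A. (sqrt (w S) * of_bool (Q S)) * (sqrt (w S) * f S))"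
    unfolding bern_expect_def w_def[symmetric]
  proof (intro sum.cong refl)
    fix S assume "S \<in> Pow A"
    then have "of_bool (Q S) * f S = f S" using assms(3)[of S] by auto
    moreover have "sqrt (w S) * sqrt (w S) = w S" using w0 by simp
    ultimately show "w S * f S = (sqrt (w S) * of_bool (Q S)) * (sqrt (w S) * f S)"
      by (metis mult.assoc mult.commute)
  qed
  also have "(\<dots>)\<^sup>2 \<le> (\<Sum>S\<in>Pow A. (sqrt (w S) * of_bool (Q S))\<^sup>2) * (\<Sum>S\<in>Pow A. (sqrt (w S) * f S)\<^sup>2)"
    by (rule Cauchy_Schwarz_ineq_sum)
  also have "(\<Sum>S\<in>Pow A. (sqrt (w S) * of_bool (Q S))\<^sup>2) = bern_expect p A (\<lambda>S. of_bool (Q S))"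
    unfolding bern_expect_def w_def[symmetric] using w0
    by (intro sum.cong) (auto simp: power_mult_distrib)
  also have "(\<Sum>S\<in>Pow A. (sqrt (w S) * f S)\<^sup>2) = bern_expect p A (\<lambda>S. (f S)\<^sup>2)"
    unfolding bern_expect_def w_def[symmetric] using w0
    by (intro sum.cong) (auto simp: power_mult_distrib)
  finally show ?thesis .
qed

lemma bern_expect_Markov:
  assumes "0 \<le> p" "p \<le> 1" "c > 0" "\<And>S. S \<subseteq> A \<Longrightarrow> 0 \<le> f S"
  shows "bern_expect p A (\<lambda>S. of_bool (c \<le> f S)) \<le> bern_expect p A f / c"
proof -
  have "bern_expect p A (\<lambda>S. of_bool (c \<le> f S)) \<le> bern_expect p A (\<lambda>S. inverse c * f S)"
    using assms by (intro bern_expect_mono) (auto simp: field_simps of_bool_def)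
  then show ?thesis unfolding bern_expect_cmult by (simp add: field_simps)
qed

section \<open>Exponential moments under bounded differences\<close>

lemma exp_le_quadratic:
  fixes x :: real
  assumes "\<bar>x\<bar> \<le> 1"
  shows "exp x \<le> 1 + x + x\<^sup>2"
proof (cases "x \<ge> 0")
  case True
  then show ?thesis using exp_bound[of x] assms by auto
next
  case False
  define y where "y = - x"
  have y: "0 \<le> y" "y \<le> 1" using False assms by (auto simp: y_def)
  have "(1 - y + y\<^sup>2) * (1 + y) = 1 + y^3" by (simp add: algebra_simps power2_eq_square power3_eq_cube)
  then have "1 \<le> (1 - y + y\<^sup>2) * (1 + y)" using y by simp
  also have "\<dots> \<le> (1 - y + y\<^sup>2) * exp y"
    using y exp_ge_add_one_self[of y] by (intro mult_left_mono) auto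
  finally have "exp (- y) \<le> 1 - y + y\<^sup>2"
    by (simp add: exp_minus field_simps)
  then show ?thesis by (simp add: y_def)
qed

text \<open>Hoeffding's lemma with the cruder constant \<open>s^2\<close> instead of
  \<open>s^2 / 8\<close>: the mean \<mu> lies within 1 of every value of \<open>f\<close>, and in
  the quadratic bound for \<open>exp\<close> the linear term averages to zero. The constant is
  harmless, since powers of \<open>n\<close> will be compared.\<close>

lemma bern_expect_exp_bound:
  assumes p: "0 \<le> p" "p \<le> 1" and A: "finite A" and s: "\<bar>s\<bar> \<le> 1"
    and f: "\<And>S T. S \<subseteq> A \<Longrightarrow> T \<subseteq> A \<Longrightarrow> \<bar>f S - f T\<bar> \<le> 1"
  shows "bern_expect p A (\<lambda>S. exp (s * f S)) \<le> exp (s * bern_expect p A f + s\<^sup>2)"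
proof -
  define \<mu> where "\<mu> = bern_expect p A f"
  have dev: "\<bar>f S - \<mu>\<bar> \<le> 1" if "S \<subseteq> A" for S
  proof -
    have bd: "f T \<le> f S + 1" "f S - 1 \<le> f T" if "T \<subseteq> A" for T
      using f[OF \<open>S \<subseteq> A\<close> that] by linarith+
    have "\<mu> \<le> f S + 1"
      unfolding \<mu>_def by (rule bern_expect_le_const[OF p A bd(1)])
    moreover have "f S - 1 \<le> \<mu>"
      unfolding \<mu>_def by (rule bern_expect_ge_const[OF p A bd(2)])
    ultimately show ?thesis by linarith
  qed
  have "bern_expect p A (\<lambda>S. exp (s * f S)) = exp (s * \<mu>) * bern_expect p A (\<lambda>S. exp (s * (f S - \<mu>)))"
    unfolding bern_expect_cmult[symmetric] exp_add[symmetric] by (simp add: algebra_simps)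
  also have "bern_expect p A (\<lambda>S. exp (s * (f S - \<mu>))) \<le> bern_expect p A (\<lambda>S. (1 + s\<^sup>2) + s * (f S - \<mu>))"
  proof (intro bern_expect_mono p)
    fix S assume S: "S \<subseteq> A"
    have a: "\<bar>s * (f S - \<mu>)\<bar> \<le> \<bar>s\<bar> * 1"
      unfolding abs_mult using dev[OF S] by (intro mult_left_mono) auto
    then have "(s * (f S - \<mu>))\<^sup>2 \<le> s\<^sup>2" by (simp add: abs_le_square_iff)
    moreover have "exp (s * (f S - \<mu>)) \<le> 1 + s * (f S - \<mu>) + (s * (f S - \<mu>))\<^sup>2"
      using a s by (intro exp_le_quadratic) auto
    ultimately show "exp (s * (f S - \<mu>)) \<le> (1 + s\<^sup>2) + s * (f S - \<mu>)" by linarith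
  qed
  also have "\<dots> = 1 + s\<^sup>2"
    using A by (simp add: bern_expect_add bern_expect_cmult bern_expect_diff \<mu>_def)
  also have "\<dots> \<le> exp (s\<^sup>2)" by simp
  finally show ?thesis by (simp add: exp_add \<mu>_def)
qed

text \<open>McDiarmid's inequality by induction on the blocks: averaging out block \<open>i\<close>
  costs a factor \<open>exp (s^2)\<close>, and the averaged function \<open>g\<close> still changes
  by at most 1 when another block is altered. The cost depends on the number of blocks and not on
  their sizes.\<close>

lemma bern_expect_bounded_differences:
  assumes p: "0 \<le> p" "p \<le> 1" and I: "finite I" and s: "\<bar>s\<bar> \<le> 1"
    and fin: "\<And>i. i \<in> I \<Longrightarrow> finite (B i)"
    and disj: "disjoint_family_on B I"
    and f: "\<And>i S T R. i \<in> I \<Longrightarrow> S \<subseteq> B i \<Longrightarrow> T \<subseteq> B i \<Longrightarrow> R \<subseteq> (\<Union>j\<in>I - {i}. B j) \<Longrightarrow>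
      \<bar>f (R \<union> S) - f (R \<union> T)\<bar> \<le> 1"
  shows "bern_expect p (\<Union>i\<in>I. B i) (\<lambda>S. exp (s * f S)) \<le>
    exp (s * bern_expect p (\<Union>i\<in>I. B i) f + s\<^sup>2 * real (card I))"
  using I fin disj f
proof (induction I arbitrary: f rule: finite_induct)
  case (insert i I)
  let ?U = "\<Union>j\<in>I. B j"
  define g where "g S = bern_expect p (B i) (\<lambda>T. f (S \<union> T))" for S
  have disj: "?U \<inter> B i = {}" "disjoint_family_on B I"
    using insert.prems(2) insert.hyps by (fastforce simp: disjoint_family_on_def)+
  have split: "bern_expect p (\<Union>j\<in>insert i I. B j) h = bern_expect p ?U (\<lambda>S. bern_expect p (B i) (\<lambda>T. h (S \<union> T)))" for h
  proof -
    have "(\<Union>j\<in>insert i I. B j) = ?U \<union> B i" by auto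
    then show ?thesis using disj insert.prems(1) insert.hyps(1) by (simp add: bern_expect_Un)
  qed
  have "bern_expect p (\<Union>j\<in>insert i I. B j) (\<lambda>S. exp (s * f S)) \<le> bern_expect p ?U (\<lambda>S. exp (s * g S + s\<^sup>2))"
    unfolding split g_def
  proof (intro bern_expect_mono p bern_expect_exp_bound s)
    fix S T T' assume "S \<subseteq> ?U" "T \<subseteq> B i" "T' \<subseteq> B i"
    then show "\<bar>f (S \<union> T) - f (S \<union> T')\<bar> \<le> 1"
      using insert.hyps(2) by (intro insert.prems(3)[of i T T' S]) auto
  qed (use insert.prems in auto)
  also have "\<dots> = exp (s\<^sup>2) * bern_expect p ?U (\<lambda>S. exp (s * g S))"
    unfolding bern_expect_cmult[symmetric] exp_add by (simp add: mult.commute)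
  also have "\<dots> \<le> exp (s\<^sup>2) * exp (s * bern_expect p ?U g + s\<^sup>2 * real (card I))"
  proof (intro mult_left_mono insert.IH)
    fix j S T R
    assume j: "j \<in> I" and ST: "S \<subseteq> B j" "T \<subseteq> B j" and R: "R \<subseteq> (\<Union>j\<in>I - {j}. B j)"
    have dev: "\<bar>f (R \<union> S \<union> V) - f (R \<union> T \<union> V)\<bar> \<le> 1" if "V \<subseteq> B i" for V
    proof -
      have "\<bar>f (R \<union> V \<union> S) - f (R \<union> V \<union> T)\<bar> \<le> 1"
        using j ST R that insert.hyps(2) by (intro insert.prems(3)[of j S T "R \<union> V"]) auto
      then show ?thesis by (simp add: Un_ac)
    qed
    have bd: "f (R \<union> S \<union> V) - f (R \<union> T \<union> V) \<le> 1" "- 1 \<le> f (R \<union> S \<union> V) - f (R \<union> T \<union> V)"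
      if "V \<subseteq> B i" for V using dev[OF that] by linarith+
    have finB: "finite (B i)" using insert.prems(1) by simp
    have "g (R \<union> S) - g (R \<union> T) \<le> 1"
      unfolding g_def bern_expect_diff[symmetric] by (rule bern_expect_le_const[OF p finB bd(1)])
    moreover have "- 1 \<le> g (R \<union> S) - g (R \<union> T)"
      unfolding g_def bern_expect_diff[symmetric] by (rule bern_expect_ge_const[OF p finB bd(2)])
    ultimately show "\<bar>g (R \<union> S) - g (R \<union> T)\<bar> \<le> 1" by linarith
  qed (use insert.prems disj in auto)
  also have "bern_expect p ?U g = bern_expect p (\<Union>j\<in>insert i I. B j) f"
    unfolding split g_def ..
  finally show ?case
    using insert.hyps unfolding exp_add[symmetric] by (simp add: algebra_simps del: UN_insert)
qed simp

lemma prob_Gnp_eq_bern_expect: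
  assumes "finite (all_edges n)"
  shows "prob_Gnp n p Q = bern_expect p (all_edges n) (\<lambda>E. of_bool (Q E))"
proof -
  have "bern_expect p (all_edges n) (\<lambda>E. of_bool (Q E)) =
    (\<Sum>E \<in> Pow (all_edges n). if Q E then p ^ card E * (1 - p) ^ (card (all_edges n) - card E) else 0)"
    unfolding bern_expect_def using assms
    by (intro sum.cong) (auto simp: card_Diff_subset finite_subset)
  also have "\<dots> = prob_Gnp n p Q"
    unfolding prob_Gnp_def using assms by (subst sum.inter_filter[symmetric]) (auto simp: Pow_def)
  finally show ?thesis by simp
qed

subsection \<open>Cliques\<close>

definition pairs_of :: "'a set \<Rightarrow> 'a set set" where
  "pairs_of V = {e. e \<subseteq> V \<and> card e = 2}"

definition cross_pairs :: "'a set \<Rightarrow> 'a set \<Rightarrow> 'a set set" where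
  "cross_pairs U V = (\<lambda>(x, y). {x, y}) ` (U \<times> V)"

lemma in_pairs_of_iff: "e \<in> pairs_of V \<longleftrightarrow> (\<exists>x\<in>V. \<exists>y\<in>V. x \<noteq> y \<and> e = {x, y})"
  by (auto simp: pairs_of_def card_2_iff)

lemma all_edges_eq: "all_edges n = pairs_of {..<n}"
  unfolding all_edges_def set_eq_iff in_pairs_of_iff by blast

lemma finite_pairs_of [simp]: "finite V \<Longrightarrow> finite (pairs_of V)"
  by (rule finite_subset[of _ "Pow V"]) (auto simp: pairs_of_def)

lemma card_pairs_of: "finite V \<Longrightarrow> card (pairs_of V) = card V choose 2"
  unfolding pairs_of_def by (rule n_subsets)

lemma pairs_of_Int: "pairs_of U \<inter> pairs_of V = pairs_of (U \<inter> V)"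
  by (auto simp: pairs_of_def)

lemma pairs_of_mono: "U \<subseteq> V \<Longrightarrow> pairs_of U \<subseteq> pairs_of V"
  by (auto simp: pairs_of_def)

lemma finite_cross_pairs [simp]: "finite U \<Longrightarrow> finite V \<Longrightarrow> finite (cross_pairs U V)"
  by (simp add: cross_pairs_def)

lemma cross_pairs_mono: "U \<subseteq> U' \<Longrightarrow> V \<subseteq> V' \<Longrightarrow> cross_pairs U V \<subseteq> cross_pairs U' V'"
  by (auto simp: cross_pairs_def)

lemma pairs_of_Un:
  assumes "U \<inter> V = {}"
  shows "pairs_of (U \<union> V) = pairs_of U \<union> pairs_of V \<union> cross_pairs U V"
proof (intro set_eqI iffI)
  fix e assume "e \<in> pairs_of (U \<union> V)"
  then show "e \<in> pairs_of U \<union> pairs_of V \<union> cross_pairs U V"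
    by (auto simp: in_pairs_of_iff cross_pairs_def insert_commute)
next
  fix e assume "e \<in> pairs_of U \<union> pairs_of V \<union> cross_pairs U V"
  then show "e \<in> pairs_of (U \<union> V)"
    using assms by (auto simp: pairs_of_def cross_pairs_def card_insert_if)
qed

lemma pairs_of_Un_disjoint:
  assumes "U \<inter> V = {}"
  shows "pairs_of U \<inter> pairs_of V = {}" "(pairs_of U \<union> pairs_of V) \<inter> cross_pairs U V = {}"
  using assms by (auto simp: pairs_of_Int in_pairs_of_iff cross_pairs_def doubleton_eq_iff)

text \<open>Three-stage exposure: whatever is selected from \<open>R\<close> and \<open>S\<close> is
  fixed before the cross edges \<open>T\<close> are drawn.\<close>

lemma bern_expect_pairs_of_Un:
  assumes "finite U" "finite V" "U \<inter> V = {}"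
  shows "bern_expect p (pairs_of (U \<union> V)) f = bern_expect p (pairs_of U) (\<lambda>R.
    bern_expect p (pairs_of V) (\<lambda>S. bern_expect p (cross_pairs U V) (\<lambda>T. f (R \<union> S \<union> T))))"
  using assms by (simp add: pairs_of_Un bern_expect_Un pairs_of_Un_disjoint)

lemma card_cross_pairs:
  assumes "finite U" "finite V" "U \<inter> V = {}"
  shows "card (cross_pairs U V) = card U * card V"
proof -
  have "inj_on (\<lambda>(x, y). {x, y}) (U \<times> V)"
    using assms by (auto simp: inj_on_def doubleton_eq_iff)
  then show ?thesis by (simp add: cross_pairs_def card_image card_cartesian_product)
qed

text \<open>The stars \<open>cross_pairs K {v}\<close> for different \<open>v\<close> are disjoint
  edge sets, so their full presence is independent from vertex to vertex, with probability
  \<open>p ^ card K\<close> each.\<close>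

lemma no_common_neighbour_prob:
  assumes "finite K" "finite V" "K \<inter> V = {}"
  shows "bern_expect p (cross_pairs K V) (\<lambda>T. of_bool (\<forall>v\<in>V. \<not> cross_pairs K {v} \<subseteq> T)) =
    (1 - p ^ card K) ^ card V"
  using assms(2,3)
proof (induction V rule: finite_induct)
  case empty
  then show ?case by (simp add: cross_pairs_def)
next
  case (insert v V)
  have disj: "cross_pairs K {v} \<inter> cross_pairs K V = {}"
    using insert.hyps insert.prems by (auto simp: cross_pairs_def doubleton_eq_iff)
  have sub: "cross_pairs K {u} \<subseteq> S \<union> T \<longleftrightarrow> cross_pairs K {u} \<subseteq> T"
    if "S \<subseteq> cross_pairs K {v}" "u \<in> V" for u S T
  proof -
    have "cross_pairs K {u} \<inter> cross_pairs K {v} = {}"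
      using that(2) insert.hyps insert.prems by (auto simp: cross_pairs_def doubleton_eq_iff)
    then show ?thesis using that(1) by blast
  qed
  have "cross_pairs K (insert v V) = cross_pairs K {v} \<union> cross_pairs K V"
    by (auto simp: cross_pairs_def)
  then have "bern_expect p (cross_pairs K (insert v V)) (\<lambda>T. of_bool (\<forall>u\<in>insert v V. \<not> cross_pairs K {u} \<subseteq> T)) =
    bern_expect p (cross_pairs K {v}) (\<lambda>S. bern_expect p (cross_pairs K V)
      (\<lambda>T. of_bool (\<forall>u\<in>insert v V. \<not> cross_pairs K {u} \<subseteq> S \<union> T)))"
    using assms(1) insert.hyps(1) disj by (simp add: bern_expect_Un)
  also have "\<dots> = bern_expect p (cross_pairs K {v}) (\<lambda>S. bern_expect p (cross_pairs K V)
      (\<lambda>T. of_bool (\<not> cross_pairs K {v} \<subseteq> S) * of_bool (\<forall>u\<in>V. \<not> cross_pairs K {u} \<subseteq> T)))"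
  proof (intro bern_expect_cong)
    fix S T assume ST: "S \<subseteq> cross_pairs K {v}" "T \<subseteq> cross_pairs K V"
    have "cross_pairs K {v} \<subseteq> S \<union> T \<longleftrightarrow> cross_pairs K {v} \<subseteq> S" using ST disj by blast
    moreover have "(\<forall>u\<in>V. \<not> cross_pairs K {u} \<subseteq> S \<union> T) \<longleftrightarrow> (\<forall>u\<in>V. \<not> cross_pairs K {u} \<subseteq> T)"
      using sub[OF ST(1)] by auto
    ultimately show "of_bool (\<forall>u\<in>insert v V. \<not> cross_pairs K {u} \<subseteq> S \<union> T) =
      (of_bool (\<not> cross_pairs K {v} \<subseteq> S) * of_bool (\<forall>u\<in>V. \<not> cross_pairs K {u} \<subseteq> T) :: real)" by simp
  qed
  also have "\<dots> = bern_expect p (cross_pairs K {v}) (\<lambda>S. of_bool (\<not> cross_pairs K {v} \<subseteq> S)) *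
      bern_expect p (cross_pairs K V) (\<lambda>T. of_bool (\<forall>u\<in>V. \<not> cross_pairs K {u} \<subseteq> T))"
    by (simp only: bern_expect_cmult bern_expect_cmult_right)
  also have "\<dots> = (1 - p ^ card K) * (1 - p ^ card K) ^ card V"
    using assms(1) insert by (simp add: bern_expect_compl bern_expect_supset card_cross_pairs)
  finally show ?case using insert.hyps by simp
qed

text \<open>A conditional bound \<open>c\<close> that is uniform over all good outcomes
  \<open>R\<close> and \<open>S\<close> lets the three probabilities multiply. It serves both to
  extend a clique and to combine the clique with the independent set.\<close>

lemma bern_expect_pairs_of_Un_cross_ge:
  assumes p: "0 \<le> p" "p \<le> 1" and UV: "finite U" "finite V" "U \<inter> V = {}" and c: "0 \<le> c"
    and cross: "\<And>R S. R \<subseteq> pairs_of U \<Longrightarrow> S \<subseteq> pairs_of V \<Longrightarrow> P R \<Longrightarrow> Q S \<Longrightarrow>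
      c \<le> bern_expect p (cross_pairs U V) (\<lambda>T. of_bool (G (R \<union> S \<union> T)))"
  shows "bern_expect p (pairs_of U) (\<lambda>R. of_bool (P R)) * bern_expect p (pairs_of V) (\<lambda>S. of_bool (Q S)) * c
    \<le> bern_expect p (pairs_of (U \<union> V)) (\<lambda>E. of_bool (G E))"
proof -
  have "bern_expect p (pairs_of U) (\<lambda>R. of_bool (P R)) * bern_expect p (pairs_of V) (\<lambda>S. of_bool (Q S)) * c =
    bern_expect p (pairs_of U) (\<lambda>R. bern_expect p (pairs_of V) (\<lambda>S. of_bool (P R) * of_bool (Q S) * c))"
    by (simp only: bern_expect_cmult bern_expect_cmult_right)
  also have "\<dots> \<le> bern_expect p (pairs_of (U \<union> V)) (\<lambda>E. of_bool (G E))"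
    unfolding bern_expect_pairs_of_Un[OF UV]
  proof (intro bern_expect_mono p)
    fix R S assume RS: "R \<subseteq> pairs_of U" "S \<subseteq> pairs_of V"
    have "0 \<le> bern_expect p (cross_pairs U V) (\<lambda>T. of_bool (G (R \<union> S \<union> T)))"
      using p UV by (intro bern_expect_ge_const) auto
    then show "of_bool (P R) * of_bool (Q S) * c \<le> bern_expect p (cross_pairs U V) (\<lambda>T. of_bool (G (R \<union> S \<union> T)))"
      using cross[OF RS] by auto
  qed
  finally show ?thesis .
qed

definition has_clique :: "nat \<Rightarrow> 'a set \<Rightarrow> 'a set set \<Rightarrow> bool" where
  "has_clique r V E \<longleftrightarrow> (\<exists>K\<subseteq>V. card K = r \<and> pairs_of K \<subseteq> E)"

text \<open>A clique \<open>K\<close> found inside \<open>U\<close> depends on no cross edge, so the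
  vertices of \<open>V\<close> are independent trials for a common neighbour of
  \<open>K\<close>.\<close>

lemma has_clique_prob_Un:
  assumes p: "0 \<le> p" "p \<le> 1" and UV: "finite U" "finite V" "U \<inter> V = {}"
  shows "bern_expect p (pairs_of U) (\<lambda>E. of_bool (has_clique r U E)) * (1 - (1 - p ^ r) ^ card V)
    \<le> bern_expect p (pairs_of (U \<union> V)) (\<lambda>E. of_bool (has_clique (Suc r) (U \<union> V) E))"
proof -
  have pr: "0 \<le> p ^ r" "p ^ r \<le> 1" using p by (auto intro: power_le_one)
  have "bern_expect p (pairs_of U) (\<lambda>E. of_bool (has_clique r U E)) *
      bern_expect p (pairs_of V) (\<lambda>S. of_bool True) * (1 - (1 - p ^ r) ^ card V)
    \<le> bern_expect p (pairs_of (U \<union> V)) (\<lambda>E. of_bool (has_clique (Suc r) (U \<union> V) E))"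
  proof (intro bern_expect_pairs_of_Un_cross_ge p UV)
    show "0 \<le> 1 - (1 - p ^ r) ^ card V" using pr by (simp add: power_le_one)
    fix R S assume "has_clique r U R"
    then obtain K where K: "K \<subseteq> U" "card K = r" "pairs_of K \<subseteq> R" by (auto simp: has_clique_def)
    have fK: "finite K" using K UV finite_subset by blast
    have KV: "K \<inter> V = {}" using K UV by auto
    have sub: "cross_pairs K V \<subseteq> cross_pairs U V" using K by (intro cross_pairs_mono) auto
    have "1 - (1 - p ^ r) ^ card V = bern_expect p (cross_pairs K V) (\<lambda>T. of_bool (\<not> (\<forall>v\<in>V. \<not> cross_pairs K {v} \<subseteq> T)))"
      using fK UV by (subst bern_expect_compl) (auto simp: no_common_neighbour_prob[OF fK UV(2) KV] K)
    \<comment> \<open>Cross edges that avoid \<open>K\<close> do not affect the event and can be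
      added to the probability space.\<close>
    also have "\<dots> = bern_expect p (cross_pairs U V)
        (\<lambda>T. of_bool (\<not> (\<forall>v\<in>V. \<not> cross_pairs K {v} \<subseteq> T \<inter> cross_pairs K V)))"
      using UV sub by (subst bern_expect_subset) auto
    also have "\<dots> \<le> bern_expect p (cross_pairs U V) (\<lambda>T. of_bool (has_clique (Suc r) (U \<union> V) (R \<union> S \<union> T)))"
    proof (intro bern_expect_mono p)
      fix T
      have "has_clique (Suc r) (U \<union> V) (R \<union> S \<union> T)" if v: "v \<in> V" "cross_pairs K {v} \<subseteq> T" for v
      proof -
        have "v \<notin> K" using v KV by auto
        then have "pairs_of (K \<union> {v}) = pairs_of K \<union> pairs_of {v} \<union> cross_pairs K {v}"
          by (intro pairs_of_Un) auto
        moreover have "pairs_of {v} = {}" by (auto simp: in_pairs_of_iff)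
        ultimately have "pairs_of (insert v K) \<subseteq> R \<union> S \<union> T" using v K by auto
        then show ?thesis
          unfolding has_clique_def using v K fK \<open>v \<notin> K\<close> by (intro exI[of _ "insert v K"]) auto
      qed
      then show "of_bool (\<not> (\<forall>v\<in>V. \<not> cross_pairs K {v} \<subseteq> T \<inter> cross_pairs K V)) \<le>
        (of_bool (has_clique (Suc r) (U \<union> V) (R \<union> S \<union> T)) :: real)" by (auto simp: of_bool_def)
    qed
    finally show "1 - (1 - p ^ r) ^ card V \<le>
      bern_expect p (cross_pairs U V) (\<lambda>T. of_bool (has_clique (Suc r) (U \<union> V) (R \<union> S \<union> T)))" .
  qed
  then show ?thesis using UV by simp
qed

text \<open>Grow the clique one vertex at a time, looking for the next vertex in a fresh block of \<open>m\<close> vertices.\<close>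

lemma has_clique_prob:
  assumes p: "0 \<le> p" "p \<le> 1"
  shows "bern_expect p (pairs_of {..<r * m}) (\<lambda>E. of_bool (has_clique r {..<r * m} E)) \<ge>
    1 - (\<Sum>i<r. exp (- real m * p ^ i))"
proof (induction r)
  case 0
  have "has_clique 0 {..<0} E" for E :: "nat set set"
    by (auto simp: has_clique_def pairs_of_def)
  then show ?case by (simp add: pairs_of_def)
next
  case (Suc r)
  let ?U = "{..<r * m}" and ?V = "{r * m..<Suc r * m}"
  let ?q = "bern_expect p (pairs_of ?U) (\<lambda>E. of_bool (has_clique r ?U E))"
  have pr: "0 \<le> p ^ r" "p ^ r \<le> 1" using p by (auto intro: power_le_one)
  have UV: "?U \<union> ?V = {..<Suc r * m}" by auto
  have "(1 - p ^ r) ^ card ?V \<le> exp (- (p ^ r)) ^ m"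
    using pr exp_ge_add_one_self[of "- (p ^ r)"] by (simp add: power_mono)
  also have "\<dots> = exp (- real m * p ^ r)" by (simp add: exp_of_nat_mult[symmetric])
  finally have "(1 - p ^ r) ^ card ?V \<le> exp (- real m * p ^ r)" .
  moreover have "?q \<le> 1" using p by (intro bern_expect_le_const) auto
  moreover have "0 \<le> ?q" using p by (intro bern_expect_ge_const) auto
  moreover have "(1 - p ^ r) ^ card ?V \<ge> 0" using pr by simp
  ultimately have "?q * (1 - p ^ r) ^ card ?V \<le> exp (- real m * p ^ r)"
    using mult_mono[of ?q 1 "(1 - p ^ r) ^ card ?V" "exp (- real m * p ^ r)"] by simp
  then have "1 - (\<Sum>i<Suc r. exp (- real m * p ^ i)) \<le> ?q * (1 - (1 - p ^ r) ^ card ?V)"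
    using Suc.IH by (simp add: algebra_simps)
  also have "\<dots> \<le> bern_expect p (pairs_of (?U \<union> ?V)) (\<lambda>E. of_bool (has_clique (Suc r) (?U \<union> ?V) E))"
    by (rule has_clique_prob_Un[OF p]) auto
  finally show ?case unfolding UV .
qed

subsection \<open>The second moment of the number of independent sets\<close>

lemma self_power_le_exp_fact: "real l ^ l \<le> exp (real l) * fact l"
proof -
  have s: "(\<lambda>n. real l ^ n / fact n) sums exp (real l)"
    using exp_converges[of "real l"] by (simp add: divide_inverse mult.commute)
  have "(\<Sum>n\<in>{l}. real l ^ n / fact n) \<le> (\<Sum>n. real l ^ n / fact n)"
    using s by (intro sum_le_suminf) (auto simp: sums_iff)
  then show ?thesis using s by (simp add: field_simps sums_iff)
qed

lemma binomial_le_exp_power: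
  assumes "0 < l"
  shows "real (k choose l) \<le> (exp 1 * real k / real l) ^ l"
proof -
  have "real (k choose l) * fact l \<le> real k ^ l"
    using binomial_fact_pow[of k l] by (metis of_nat_fact of_nat_le_iff of_nat_mult of_nat_power)
  then have "real (k choose l) \<le> real k ^ l / fact l" by (simp add: field_simps)
  also have "\<dots> = real k ^ l * (1 / fact l)" by simp
  also have "\<dots> \<le> real k ^ l * (exp (real l) / real l ^ l)"
    using self_power_le_exp_fact[of l] assms by (intro mult_left_mono) (simp_all add: field_simps)
  also have "\<dots> = (exp 1 * real k / real l) ^ l"
    by (simp add: power_mult_distrib power_divide exp_of_nat_mult[of l 1, simplified])
  finally show ?thesis .
qed

text \<open>Denominators are cleared: a random \<open>k\<close>-subset of \<open>n\<close> points
  contains \<open>l\<close> given points with probability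
  \<open>\<Prod>i<l. (k - i) / (n - i)\<close>, and no factor exceeds \<open>k / n\<close>.\<close>

lemma choose_diff_mult_power_le:
  assumes "l \<le> k" "k \<le> n"
  shows "((n - l) choose (k - l)) * n ^ l \<le> k ^ l * (n choose k)"
  using assms(1)
proof (induction l)
  case (Suc l)
  have nl: "n - l = Suc (n - Suc l)" "k - l = Suc (k - Suc l)" using Suc.prems assms(2) by auto
  have "(n - l) * ((n - Suc l) choose (k - Suc l)) = (k - l) * ((n - l) choose (k - l))"
    using Suc_times_binomial[of "k - Suc l" "n - Suc l"] nl by simp
  then have "(n - l) * (((n - Suc l) choose (k - Suc l)) * n ^ Suc l) =
      (k - l) * n * (((n - l) choose (k - l)) * n ^ l)"
    by (simp add: mult_ac)
  also have "\<dots> \<le> (k - l) * n * (k ^ l * (n choose k))"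
    using Suc by (intro mult_left_mono) auto
  also have "\<dots> \<le> ((n - l) * k) * (k ^ l * (n choose k))"
  proof (intro mult_right_mono)
    \<comment> \<open>In quotients, the goal is
      \<open>(k - l) / (n - l) \<le> k / n\<close>.\<close>
    have "(k - l) * n = k * n - l * n" "(n - l) * k = k * n - l * k"
      by (simp_all add: diff_mult_distrib mult.commute[of n k])
    then show "(k - l) * n \<le> (n - l) * k" using assms(2) by (simp add: diff_le_mono2)
  qed auto
  finally have "(n - l) * (((n - Suc l) choose (k - Suc l)) * n ^ Suc l) \<le> (n - l) * (k ^ Suc l * (n choose k))"
    by (simp add: mult_ac)
  moreover have "n - l > 0" using Suc.prems assms(2) by simp
  ultimately show ?case using mult_le_cancel1 by blast
qed simp

lemma card_supersets:
  assumes "finite V" "T \<subseteq> V" "card T = l" "l \<le> k"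
  shows "card {J. J \<subseteq> V \<and> card J = k \<and> T \<subseteq> J} = (card V - l) choose (k - l)"
proof -
  have fT: "finite T" using assms finite_subset by blast
  have "bij_betw (\<lambda>J. J - T) {J. J \<subseteq> V \<and> card J = k \<and> T \<subseteq> J} {R. R \<subseteq> V - T \<and> card R = k - l}"
  proof (rule bij_betw_byWitness[where f' = "\<lambda>R. R \<union> T"])
    show "(\<lambda>J. J - T) ` {J. J \<subseteq> V \<and> card J = k \<and> T \<subseteq> J} \<subseteq> {R. R \<subseteq> V - T \<and> card R = k - l}"
      using assms fT by (auto simp: card_Diff_subset)
    have "card (R \<union> T) = k" if "R \<subseteq> V - T" "card R = k - l" for R
      using that assms fT finite_subset[of R "V - T"] by (subst card_Un_disjoint) auto
    then show "(\<lambda>R. R \<union> T) ` {R. R \<subseteq> V - T \<and> card R = k - l} \<subseteq> {J. J \<subseteq> V \<and> card J = k \<and> T \<subseteq> J}"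
      using assms by auto
  qed auto
  then have "card {J. J \<subseteq> V \<and> card J = k \<and> T \<subseteq> J} = card {R. R \<subseteq> V - T \<and> card R = k - l}"
    by (rule bij_betw_same_card)
  also have "\<dots> = (card V - l) choose (k - l)"
    using assms fT by (subst n_subsets) (auto simp: card_Diff_subset)
  finally show ?thesis .
qed

text \<open>Union bound over the possible intersections \<open>T\<close>; that \<open>J\<close> has
  to avoid the rest of \<open>I\<close> is given away.\<close>

lemma card_subsets_meeting_le:
  assumes "finite V" "I \<subseteq> V" "card I = k" "l \<le> k"
  shows "card {J. J \<subseteq> V \<and> card J = k \<and> card (I \<inter> J) = l} \<le> (k choose l) * ((card V - l) choose (k - l))"
proof -
  have fI: "finite I" using assms finite_subset by blast
  let ?T = "{T. T \<subseteq> I \<and> card T = l}"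
  have "{J. J \<subseteq> V \<and> card J = k \<and> card (I \<inter> J) = l} \<subseteq> (\<Union>T\<in>?T. {J. J \<subseteq> V \<and> card J = k \<and> T \<subseteq> J})"
    by auto
  then have "card {J. J \<subseteq> V \<and> card J = k \<and> card (I \<inter> J) = l} \<le>
      card (\<Union>T\<in>?T. {J. J \<subseteq> V \<and> card J = k \<and> T \<subseteq> J})"
    using assms(1) fI by (intro card_mono) auto
  also have "\<dots> \<le> (\<Sum>T\<in>?T. card {J. J \<subseteq> V \<and> card J = k \<and> T \<subseteq> J})"
    using fI by (intro card_UN_le) auto
  also have "\<dots> = (\<Sum>T\<in>?T. (card V - l) choose (k - l))"
    using assms by (intro sum.cong card_supersets) auto
  also have "\<dots> = (k choose l) * ((card V - l) choose (k - l))"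
    using fI assms by (simp add: n_subsets)
  finally show ?thesis .
qed

lemma sum_half_powers_le: "(\<Sum>l\<in>{L..k}. (1 / 2 :: real) ^ l) \<le> 2 * (1 / 2) ^ L"
proof (cases "L \<le> k")
  case True
  then have "(\<Sum>l\<in>{L..k}. (1 / 2 :: real) ^ l) = 2 * ((1 / 2) ^ L - (1 / 2) ^ Suc k)"
    by (subst sum_gp) auto
  also have "\<dots> \<le> 2 * (1 / 2) ^ L" by simp
  finally show ?thesis .
next
  case False then show ?thesis by simp
qed

section \<open>Contribution of each overlap size to the second moment\<close>

lemma inverse_power_choose_two_le:
  fixes p :: real
  assumes "0 \<le> p" "p < 1"
  shows "(1 / (1 - p)) ^ (l choose 2) \<le> exp (p / (1 - p) * (real l ^ 2 / 2))"
proof -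
  \<comment> \<open>The origin of \<theta>: the factor gained for each pair shared by two
    \<open>k\<close>-sets is \<open>1 + \<theta>\<close>, at most
    \<open>exp \<theta>\<close>.\<close>
  have "1 / (1 - p) = 1 + p / (1 - p)" using assms by (simp add: field_simps)
  also have "\<dots> \<le> exp (p / (1 - p))" by simp
  finally have "(1 / (1 - p)) ^ (l choose 2) \<le> exp (p / (1 - p)) ^ (l choose 2)"
    using assms by (intro power_mono) auto
  also have "\<dots> = exp (p / (1 - p) * real (l choose 2))" by (rule exp_of_nat2_mult[symmetric])
  also have "\<dots> \<le> exp (p / (1 - p) * (real l ^ 2 / 2))"
  proof -
    have "(l choose 2) * 2 \<le> l ^ 2" using binomial_fact_pow[of l 2] by simp
    then have "real (l choose 2) * 2 \<le> real l ^ 2" by (metis of_nat_le_iff of_nat_mult of_nat_numeral of_nat_power)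
    then have "real (l choose 2) \<le> real l ^ 2 / 2" by simp
    then have "p / (1 - p) * real (l choose 2) \<le> p / (1 - p) * (real l ^ 2 / 2)"
      using assms by (intro mult_left_mono) auto
    then show ?thesis by simp
  qed
  finally show ?thesis .
qed

text \<open>The left side is at most the \<open>l\<close>-th power of a base that is proportional to
  \<open>exp (\<theta> * l / 2) / l\<close>. This function of \<open>l\<close> falls until
  \<open>2 / \<theta>\<close> and rises afterwards, so it is governed by the ends of the range:
  \<open>small\<close> handles the end \<open>L\<close>, \<open>large\<close> the end
  \<open>k\<close>.\<close>

lemma overlap_term_le:
  fixes p :: real
  defines "\<theta> \<equiv> p / (1 - p)"
  assumes p: "0 \<le> p" "p < 1" and N: "0 < N" and L: "0 < L" "L \<le> l" "l \<le> k"
    and small: "exp 2 * real k ^ 2 / (real L * real N) \<le> 1 / 2"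
    and large: "exp 1 * real k ^ 2 * \<theta> / real N * exp (\<theta> * real k / 2) \<le> 1"
  shows "real (k choose l) * (real k / real N) ^ l * (1 / (1 - p)) ^ (l choose 2) \<le> (1 / 2) ^ l"
proof -
  have \<theta>: "\<theta> \<ge> 0" using p by (simp add: \<theta>_def)
  have l: "0 < l" using L by simp
  have "(1 / (1 - p)) ^ (l choose 2) \<le> exp (\<theta> * (real l ^ 2 / 2))"
    unfolding \<theta>_def by (rule inverse_power_choose_two_le[OF p])
  also have "\<dots> = exp (\<theta> * real l / 2) ^ l"
    unfolding exp_of_nat2_mult[symmetric] by (simp add: power2_eq_square)
  finally have q: "(1 / (1 - p)) ^ (l choose 2) \<le> exp (\<theta> * real l / 2) ^ l" .
  let ?b = "exp 1 * real k / real l * (real k / real N) * exp (\<theta> * real l / 2)"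
  have "real (k choose l) * (real k / real N) ^ l * (1 / (1 - p)) ^ (l choose 2) \<le>
      (exp 1 * real k / real l) ^ l * (real k / real N) ^ l * exp (\<theta> * real l / 2) ^ l"
    using binomial_le_exp_power[OF l, of k] q p by (intro mult_mono) auto
  also have "\<dots> = ?b ^ l" by (simp only: power_mult_distrib)
  also have "\<dots> \<le> (1 / 2) ^ l"
  proof (intro power_mono)
    show "?b \<le> 1 / 2"
    \<comment> \<open>The split is at the minimum of \<open>exp (\<theta> * l / 2) / l\<close>. On
      the left the exponential is at most \<open>exp 1\<close>, on the right \<open>1 / l\<close> is
      at most \<open>\<theta> / 2\<close>.\<close>
    proof (cases "\<theta> * real l \<le> 2")
      case True
      have "exp 1 * real k / real l \<le> exp 1 * real k / real L"
        using L by (intro divide_left_mono) auto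
      then have "?b \<le> exp 1 * real k / real L * (real k / real N) * exp 1"
        using True by (intro mult_mono) auto
      also have "\<dots> = exp 2 * real k ^ 2 / (real L * real N)"
        using exp_add[of 1 "1::real"] by (simp add: power2_eq_square)
      finally show ?thesis using small by linarith
    next
      case False
      have inv: "1 / real l \<le> \<theta> / 2" using False l by (simp add: field_simps)
      have "?b = (exp 1 * real k * (real k / real N) * exp (\<theta> * real l / 2)) * (1 / real l)" by simp
      also have "\<dots> \<le> (exp 1 * real k * (real k / real N) * exp (\<theta> * real k / 2)) * (\<theta> / 2)"
        using inv L \<theta> by (intro mult_mono) (auto intro!: mult_left_mono)
      also have "\<dots> = (exp 1 * real k ^ 2 * \<theta> / real N * exp (\<theta> * real k / 2)) / 2"
        by (simp add: power2_eq_square)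
      also have "\<dots> \<le> 1 / 2" using large by (intro divide_right_mono) auto
      finally show ?thesis .
    qed
  qed simp
  finally show ?thesis .
qed

lemma overlap_sum_le:
  fixes p :: real
  defines "\<theta> \<equiv> p / (1 - p)"
  assumes p: "0 \<le> p" "p < 1" and V: "finite V" "card V = N" and I: "I \<subseteq> V" "card I = k"
    and k: "0 < k" and L: "0 < L"
    and small: "exp 2 * real k ^ 2 / (real L * real N) \<le> 1 / 2"
    and large: "exp 1 * real k ^ 2 * \<theta> / real N * exp (\<theta> * real k / 2) \<le> 1"
  shows "(\<Sum>J | J \<subseteq> V \<and> card J = k. (1 / (1 - p)) ^ (card (I \<inter> J) choose 2)) \<le>
    real (N choose k) * (exp (\<theta> * real L ^ 2 / 2) + 2 * (1 / 2) ^ L)"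
proof -
  let ?F = "{J. J \<subseteq> V \<and> card J = k}"
  let ?w = "\<lambda>l. (1 / (1 - p)) ^ (l choose 2)"
  have finF: "finite ?F" using V by simp
  have fI: "finite I" using I V finite_subset by blast
  have \<theta>: "\<theta> \<ge> 0" using p by (simp add: \<theta>_def)
  have kN: "k \<le> N" using I V card_mono by blast
  have Npos: "0 < N" using kN k by simp
  have w0: "0 \<le> ?w l" for l using p by simp
  have le: "card (I \<inter> J) \<le> k" for J using I fI by (metis card_mono inf_le1)
  have low: "?w l \<le> exp (\<theta> * real L ^ 2 / 2)" if "l < L" for l
  proof -
    have "?w l \<le> exp (\<theta> * (real l ^ 2 / 2))"
      unfolding \<theta>_def by (rule inverse_power_choose_two_le[OF p])
    also have "\<dots> \<le> exp (\<theta> * (real L ^ 2 / 2))"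
    proof -
      have "real l ^ 2 / 2 \<le> real L ^ 2 / 2" using that by (simp add: power_mono)
      then have "\<theta> * (real l ^ 2 / 2) \<le> \<theta> * (real L ^ 2 / 2)" using \<theta> by (rule mult_left_mono)
      then show ?thesis by simp
    qed
    finally show ?thesis by simp
  qed
  have "(\<Sum>J\<in>?F. ?w (card (I \<inter> J))) = (\<Sum>l\<le>k. \<Sum>J | J \<in> ?F \<and> card (I \<inter> J) = l. ?w (card (I \<inter> J)))"
    using finF le by (intro sum.group[symmetric]) auto
  also have "\<dots> = (\<Sum>l\<le>k. real (card {J. J \<subseteq> V \<and> card J = k \<and> card (I \<inter> J) = l}) * ?w l)"
    by (intro sum.cong refl) (simp add: conj_assoc)
  \<comment> \<open>The first summand is kept for all \<open>l\<close>, also above \<open>L\<close>,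
    so that the counts add up to the full binomial coefficient.\<close>
  also have "\<dots> \<le> (\<Sum>l\<le>k. real (card {J. J \<subseteq> V \<and> card J = k \<and> card (I \<inter> J) = l}) * exp (\<theta> * real L ^ 2 / 2)
      + (if L \<le> l then real (N choose k) * (1 / 2) ^ l else 0))"
  proof (intro sum_mono)
    fix l assume l: "l \<in> {..k}"
    let ?c = "card {J. J \<subseteq> V \<and> card J = k \<and> card (I \<inter> J) = l}"
    show "real ?c * ?w l \<le> real ?c * exp (\<theta> * real L ^ 2 / 2) + (if L \<le> l then real (N choose k) * (1 / 2) ^ l else 0)"
    proof (cases "L \<le> l")
      case True
      have "real ?c \<le> real (k choose l) * real ((N - l) choose (k - l))"
        using card_subsets_meeting_le[OF V(1) I, of l] l V(2)
        by (simp flip: of_nat_mult del: of_nat_mult)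
      also have "\<dots> \<le> real (k choose l) * ((real k / real N) ^ l * real (N choose k))"
      proof (intro mult_left_mono)
        have "real ((N - l) choose (k - l)) * real N ^ l \<le> real k ^ l * real (N choose k)"
          using choose_diff_mult_power_le[of l k N] l kN by (simp flip: of_nat_mult of_nat_power)
        then show "real ((N - l) choose (k - l)) \<le> (real k / real N) ^ l * real (N choose k)"
          using Npos by (simp add: field_simps)
      qed simp
      finally have "real ?c * ?w l \<le> real (k choose l) * ((real k / real N) ^ l * real (N choose k)) * ?w l"
        using w0 by (intro mult_right_mono)
      also have "\<dots> = real (N choose k) * (real (k choose l) * (real k / real N) ^ l * ?w l)"
        by (simp add: mult_ac)
      also have "\<dots> \<le> real (N choose k) * (1 / 2) ^ l"
        using overlap_term_le[OF p Npos L True] l small large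
        by (intro mult_left_mono) (auto simp: \<theta>_def)
      finally show ?thesis using True by (simp add: add_increasing)
    next
      case False
      then show ?thesis using low[of l] by (simp add: mult_left_mono)
    qed
  qed
  also have "\<dots> = (\<Sum>l\<le>k. real (card {J. J \<subseteq> V \<and> card J = k \<and> card (I \<inter> J) = l})) * exp (\<theta> * real L ^ 2 / 2)
      + real (N choose k) * (\<Sum>l\<in>{L..k}. (1 / 2) ^ l)"
  proof -
    have "(\<Sum>l\<le>k. if L \<le> l then real (N choose k) * (1 / 2) ^ l else 0) =
        (\<Sum>l\<in>{L..k}. real (N choose k) * (1 / 2) ^ l)"
      by (subst sum.inter_filter[symmetric]) (auto intro!: sum.cong)
    then show ?thesis by (simp add: sum.distrib sum_distrib_left sum_distrib_right)
  qed
  also have "(\<Sum>l\<le>k. real (card {J. J \<subseteq> V \<and> card J = k \<and> card (I \<inter> J) = l})) = real (N choose k)"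
  proof -
    have "(\<Sum>l\<le>k. \<Sum>J | J \<in> ?F \<and> card (I \<inter> J) = l. 1) = (\<Sum>J\<in>?F. 1 :: real)"
      using finF le by (intro sum.group) auto
    then show ?thesis using V by (simp add: conj_assoc n_subsets)
  qed
  also have "real (N choose k) * (\<Sum>l\<in>{L..k}. (1 / 2) ^ l) \<le> real (N choose k) * (2 * (1 / 2) ^ L)"
    by (intro mult_left_mono sum_half_powers_le) auto
  finally show ?thesis by (simp add: algebra_simps)
qed

definition has_indep :: "nat \<Rightarrow> 'a set \<Rightarrow> 'a set set \<Rightarrow> bool" where
  "has_indep k V E \<longleftrightarrow> (\<exists>I\<subseteq>V. card I = k \<and> pairs_of I \<inter> E = {})"

text \<open>The bracket bounds the second moment of the number of independent \<open>k\<close>-sets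
  divided by the squared mean. The product form stays informative when the bracket is huge.\<close>

lemma has_indep_prob_ge:
  fixes p :: real
  defines "\<theta> \<equiv> p / (1 - p)"
  assumes p: "0 \<le> p" "p < 1" and V: "finite V" "card V = N"
    and k: "0 < k" "k \<le> N" and L: "0 < L"
    and small: "exp 2 * real k ^ 2 / (real L * real N) \<le> 1 / 2"
    and large: "exp 1 * real k ^ 2 * \<theta> / real N * exp (\<theta> * real k / 2) \<le> 1"
  shows "1 \<le> bern_expect p (pairs_of V) (\<lambda>E. of_bool (has_indep k V E)) *
    (exp (\<theta> * real L ^ 2 / 2) + 2 * (1 / 2) ^ L)"
proof -
  let ?F = "{J. J \<subseteq> V \<and> card J = k}"
  let ?E = "bern_expect p (pairs_of V)"
  let ?M = "real (N choose k)"
  let ?q = "(1 - p) ^ (k choose 2)"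
  define R where "R = exp (\<theta> * real L ^ 2 / 2) + 2 * (1 / 2) ^ L"
  define X where "X E = (\<Sum>I\<in>?F. of_bool (pairs_of I \<inter> E = {}) :: real)" for E :: "'a set set"
  have p': "p \<le> 1" "0 < 1 - p" using p by auto
  have finF: "finite ?F" using V by simp
  have cardF: "real (card ?F) = ?M" using V by (simp add: n_subsets)
  have fin: "finite I" if "I \<in> ?F" for I using that V finite_subset by blast
  have pos: "?q > 0" "?M > 0" using p k by auto
  have mean: "?E X = ?M * ?q"
  proof -
    have "?E X = (\<Sum>I\<in>?F. ?E (\<lambda>E. of_bool (pairs_of I \<inter> E = {})))"
      unfolding X_def by (rule bern_expect_sum)
    also have "\<dots> = (\<Sum>I\<in>?F. ?q)"
    proof (intro sum.cong refl)
      fix I assume I: "I \<in> ?F"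
      have "?E (\<lambda>E. of_bool (pairs_of I \<inter> E = {})) = (1 - p) ^ card (pairs_of I)"
        using V(1) I pairs_of_mono[of I V] by (intro bern_expect_disjoint) auto
      then show "?E (\<lambda>E. of_bool (pairs_of I \<inter> E = {})) = ?q"
        using I fin[OF I] by (simp add: card_pairs_of)
    qed
    finally show ?thesis using cardF by simp
  qed
  have pairq: "?E (\<lambda>E. of_bool ((pairs_of I \<union> pairs_of J) \<inter> E = {})) =
      ?q\<^sup>2 * (1 / (1 - p)) ^ (card (I \<inter> J) choose 2)" if IJ: "I \<in> ?F" "J \<in> ?F" for I J
  proof -
    \<comment> \<open>The pairs lying in both sets are those of \<open>I \<inter> J\<close>; they
      have to be absent only once, which yields the correction factor.\<close>
    have c: "card (pairs_of I \<union> pairs_of J) + (card (I \<inter> J) choose 2) = (k choose 2) + (k choose 2)"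
      using card_Un_Int[of "pairs_of I" "pairs_of J"] IJ fin[OF IJ(1)] fin[OF IJ(2)]
      by (simp add: pairs_of_Int card_pairs_of)
    have "?E (\<lambda>E. of_bool ((pairs_of I \<union> pairs_of J) \<inter> E = {})) = (1 - p) ^ card (pairs_of I \<union> pairs_of J)"
      using V(1) IJ pairs_of_mono[of I V] pairs_of_mono[of J V] by (intro bern_expect_disjoint) auto
    moreover have "(1 - p) ^ card (pairs_of I \<union> pairs_of J) * (1 - p) ^ (card (I \<inter> J) choose 2) = ?q * ?q"
      using c by (metis power_add)
    ultimately show ?thesis using p'(2) by (simp add: field_simps power2_eq_square)
  qed
  have "?E (\<lambda>E. (X E)\<^sup>2) = ?E (\<lambda>E. \<Sum>I\<in>?F. \<Sum>J\<in>?F. of_bool ((pairs_of I \<union> pairs_of J) \<inter> E = {}))"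
  proof (intro bern_expect_cong)
    fix E
    have "(X E)\<^sup>2 = (\<Sum>I\<in>?F. \<Sum>J\<in>?F. of_bool (pairs_of I \<inter> E = {}) * of_bool (pairs_of J \<inter> E = {}))"
      unfolding X_def power2_eq_square by (rule sum_product)
    also have "\<dots> = (\<Sum>I\<in>?F. \<Sum>J\<in>?F. of_bool ((pairs_of I \<union> pairs_of J) \<inter> E = {}))"
      by (intro sum.cong refl) (auto simp: Int_Un_distrib2)
    finally show "(X E)\<^sup>2 = \<dots>" .
  qed
  also have "\<dots> = (\<Sum>I\<in>?F. \<Sum>J\<in>?F. ?E (\<lambda>E. of_bool ((pairs_of I \<union> pairs_of J) \<inter> E = {})))"
    by (simp only: bern_expect_sum)
  also have "\<dots> = (\<Sum>I\<in>?F. ?q\<^sup>2 * (\<Sum>J\<in>?F. (1 / (1 - p)) ^ (card (I \<inter> J) choose 2)))"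
    unfolding sum_distrib_left by (intro sum.cong refl) (use pairq in blast)
  also have "\<dots> \<le> (\<Sum>I\<in>?F. ?q\<^sup>2 * (?M * R))"
  proof (intro sum_mono mult_left_mono)
    fix I assume "I \<in> ?F"
    then show "(\<Sum>J\<in>?F. (1 / (1 - p)) ^ (card (I \<inter> J) choose 2)) \<le> ?M * R"
      unfolding R_def \<theta>_def using p V k L small large by (intro overlap_sum_le) (auto simp: \<theta>_def)
  qed auto
  also have "\<dots> = (?M * ?q)\<^sup>2 * R" using cardF by (simp add: power2_eq_square)
  finally have second: "?E (\<lambda>E. (X E)\<^sup>2) \<le> (?M * ?q)\<^sup>2 * R" .
  have X0: "X E = 0" if "\<not> has_indep k V E" for E
    unfolding X_def using that by (intro sum.neutral) (auto simp: has_indep_def)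
  have "(?M * ?q)\<^sup>2 \<le> ?E (\<lambda>E. of_bool (has_indep k V E)) * ?E (\<lambda>E. (X E)\<^sup>2)"
    using bern_expect_Cauchy_Schwarz[of p "pairs_of V" "has_indep k V" X] p X0 mean by simp
  also have "\<dots> \<le> ?E (\<lambda>E. of_bool (has_indep k V E)) * ((?M * ?q)\<^sup>2 * R)"
    using second p V by (intro mult_left_mono bern_expect_ge_const) auto
  finally have "(?M * ?q)\<^sup>2 * 1 \<le> (?M * ?q)\<^sup>2 * (?E (\<lambda>E. of_bool (has_indep k V E)) * R)"
    by (simp add: mult_ac)
  moreover have "(?M * ?q)\<^sup>2 > 0" using mult_pos_pos[OF pos(2,1)] by (rule zero_less_power)
  ultimately show ?thesis unfolding R_def using mult_le_cancel_left_pos by blast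
qed

subsection \<open>Concentration of the independence number\<close>

definition indep_num :: "'a set \<Rightarrow> 'a set set \<Rightarrow> nat" where
  "indep_num V E = Max (card ` {I. I \<subseteq> V \<and> pairs_of I \<inter> E = {}})"

lemma indep_num_ge:
  assumes "finite V" "I \<subseteq> V" "pairs_of I \<inter> E = {}"
  shows "card I \<le> indep_num V E"
  unfolding indep_num_def using assms by (intro Max_ge) auto

lemma indep_num_witness:
  assumes "finite V"
  obtains I where "I \<subseteq> V" "pairs_of I \<inter> E = {}" "card I = indep_num V E"
proof -
  have "{} \<in> {I. I \<subseteq> V \<and> pairs_of I \<inter> E = {}}" by (auto simp: pairs_of_def)
  then have "indep_num V E \<in> card ` {I. I \<subseteq> V \<and> pairs_of I \<inter> E = {}}"
    unfolding indep_num_def using assms by (intro Max_in) auto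
  then show thesis using that by auto
qed

text \<open>Independent sets can be shrunk to any smaller size. This turns the second moment bound
  into one for \<open>indep_num\<close>, the quantity that is Lipschitz.\<close>

lemma has_indep_iff:
  assumes "finite V"
  shows "has_indep k V E \<longleftrightarrow> k \<le> indep_num V E"
proof
  assume "has_indep k V E"
  then show "k \<le> indep_num V E" using indep_num_ge[OF assms] by (auto simp: has_indep_def)
next
  assume k: "k \<le> indep_num V E"
  obtain I where I: "I \<subseteq> V" "pairs_of I \<inter> E = {}" "card I = indep_num V E"
    using indep_num_witness[OF assms] .
  obtain J where "J \<subseteq> I" "card J = k" using obtain_subset_with_card_n[of k I] k I(3) by auto
  then show "has_indep k V E"
    unfolding has_indep_def using I pairs_of_mono[of J I] by (intro exI[of _ J]) auto
qed

text \<open>Deleting \<open>v\<close> from a maximum independent set protects it against every edge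
  at \<open>v\<close>.\<close>

lemma indep_num_vertex_Lipschitz:
  assumes V: "finite V" and S: "\<And>e. e \<in> T \<Longrightarrow> v \<in> e"
  shows "indep_num V (R \<union> S) \<le> indep_num V (R \<union> T) + 1"
proof -
  obtain I where I: "I \<subseteq> V" "pairs_of I \<inter> (R \<union> S) = {}" "card I = indep_num V (R \<union> S)"
    using indep_num_witness[OF V] .
  have "pairs_of (I - {v}) \<inter> T = {}" using S by (auto simp: pairs_of_def)
  moreover have "pairs_of (I - {v}) \<inter> R = {}" using I pairs_of_mono[of "I - {v}" I] by blast
  ultimately have "card (I - {v}) \<le> indep_num V (R \<union> T)"
    using I V by (intro indep_num_ge) auto
  moreover have "card I \<le> card (I - {v}) + 1" using diff_card_le_card_Diff[of "{v}" I] by simp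
  ultimately show ?thesis using I by linarith
qed

text \<open>Vertex exposure: each edge is assigned to its larger endpoint, for which the linear
  order is used. With one block per vertex the exponent carries \<open>card V\<close>; exposing edge
  by edge would put the number of pairs there.\<close>

lemma indep_num_exp_moment:
  fixes V :: "'a :: linorder set"
  assumes p: "0 \<le> p" "p \<le> 1" and V: "finite V" and s: "\<bar>s\<bar> \<le> 1"
  shows "bern_expect p (pairs_of V) (\<lambda>E. exp (s * real (indep_num V E))) \<le>
    exp (s * bern_expect p (pairs_of V) (\<lambda>E. real (indep_num V E)) + s\<^sup>2 * real (card V))"
proof -
  define B where "B v = (\<lambda>x. {x, v}) ` {x \<in> V. x < v}" for v
  have U: "(\<Union>v\<in>V. B v) = pairs_of V"
  proof (intro set_eqI iffI)
    fix e assume "e \<in> (\<Union>v\<in>V. B v)"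
    then show "e \<in> pairs_of V" by (auto simp: B_def pairs_of_def card_insert_if)
  next
    fix e assume "e \<in> pairs_of V"
    then obtain x y where xy: "x \<in> V" "y \<in> V" "x \<noteq> y" "e = {x, y}" unfolding in_pairs_of_iff by blast
    show "e \<in> (\<Union>v\<in>V. B v)"
    proof (cases "x < y")
      case True then show ?thesis using xy by (auto simp: B_def)
    next
      case False then have "y < x" using xy by simp
      then show ?thesis using xy by (auto simp: B_def intro!: bexI[of _ x])
    qed
  qed
  have disj: "disjoint_family_on B V"
    unfolding disjoint_family_on_def by (auto simp: B_def doubleton_eq_iff)
  have B: "v \<in> e" if "e \<in> T" "T \<subseteq> B v" for v e T using that by (auto simp: B_def)
  have "bern_expect p (\<Union>v\<in>V. B v) (\<lambda>E. exp (s * real (indep_num V E))) \<le>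
    exp (s * bern_expect p (\<Union>v\<in>V. B v) (\<lambda>E. real (indep_num V E)) + s\<^sup>2 * real (card V))"
  proof (rule bern_expect_bounded_differences[OF p V s _ disj])
    show "finite (B v)" for v using V by (simp add: B_def)
    fix v S T R assume ST: "S \<subseteq> B v" "T \<subseteq> B v"
    have "indep_num V (R \<union> S) \<le> indep_num V (R \<union> T) + 1" "indep_num V (R \<union> T) \<le> indep_num V (R \<union> S) + 1"
      using B ST by (intro indep_num_vertex_Lipschitz[OF V, where v = v]; blast)+
    then show "\<bar>real (indep_num V (R \<union> S)) - real (indep_num V (R \<union> T))\<bar> \<le> 1" by linarith
  qed
  then show ?thesis unfolding U .
qed

text \<open>Chernoff bounds for both tails with the same \<open>s\<close>. In their product the mean
  \<mu> cancels, so nothing needs to be known about its location.\<close>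

lemma indep_num_concentration:
  fixes V :: "'a :: linorder set"
  assumes p: "0 \<le> p" "p \<le> 1" and V: "finite V" and s: "0 < s" "s \<le> 1"
  shows "bern_expect p (pairs_of V) (\<lambda>E. of_bool (real (indep_num V E) \<le> r)) *
    bern_expect p (pairs_of V) (\<lambda>E. of_bool (k \<le> real (indep_num V E))) \<le>
    exp (2 * s\<^sup>2 * real (card V) - s * (k - r))"
proof -
  let ?E = "bern_expect p (pairs_of V)"
  let ?f = "\<lambda>E. real (indep_num V E)"
  define \<mu> where "\<mu> = ?E ?f"
  let ?N = "real (card V)"
  have fin: "finite (pairs_of V)" using V by simp
  have "exp (s * k) * ?E (\<lambda>E. of_bool (k \<le> ?f E)) \<le> ?E (\<lambda>E. exp (s * ?f E))"
    unfolding bern_expect_cmult[symmetric] using s by (intro bern_expect_mono p) (auto simp: of_bool_def)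
  also have "\<dots> \<le> exp (s * \<mu> + s\<^sup>2 * ?N)"
    unfolding \<mu>_def using s by (intro indep_num_exp_moment p V) auto
  finally have 1: "exp (s * k) * ?E (\<lambda>E. of_bool (k \<le> ?f E)) \<le> exp (s * \<mu> + s\<^sup>2 * ?N)" .
  have "exp (- s * r) * ?E (\<lambda>E. of_bool (?f E \<le> r)) \<le> ?E (\<lambda>E. exp (- s * ?f E))"
    unfolding bern_expect_cmult[symmetric] using s by (intro bern_expect_mono p) (auto simp: of_bool_def)
  also have "\<dots> \<le> exp (- s * \<mu> + (- s)\<^sup>2 * ?N)"
    unfolding \<mu>_def using s by (intro indep_num_exp_moment p V) auto
  finally have 2: "exp (- s * r) * ?E (\<lambda>E. of_bool (?f E \<le> r)) \<le> exp (- s * \<mu> + s\<^sup>2 * ?N)" by simp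
  have nn: "0 \<le> ?E (\<lambda>E. of_bool (Q E))" for Q using p fin by (intro bern_expect_ge_const) auto
  have "exp (- s * r) * ?E (\<lambda>E. of_bool (?f E \<le> r)) * (exp (s * k) * ?E (\<lambda>E. of_bool (k \<le> ?f E))) \<le>
      exp (- s * \<mu> + s\<^sup>2 * ?N) * exp (s * \<mu> + s\<^sup>2 * ?N)"
    using nn by (intro mult_mono[OF 2 1]) auto
  also have "\<dots> = exp (2 * s\<^sup>2 * ?N)" unfolding exp_add[symmetric] by simp
  finally have "exp (s * (k - r)) * (?E (\<lambda>E. of_bool (?f E \<le> r)) * ?E (\<lambda>E. of_bool (k \<le> ?f E))) \<le> exp (2 * s\<^sup>2 * ?N)"
    by (simp add: algebra_simps exp_diff exp_minus divide_inverse)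
  then show ?thesis unfolding exp_diff by (simp add: field_simps)
qed

section \<open>Discarding the neighbours of the clique\<close>

lemma few_cross_edges_prob:
  assumes p: "0 \<le> p" "p \<le> 1" and fin: "finite U" "finite V" and KI: "K \<subseteq> U" "I \<subseteq> V" "K \<inter> I = {}"
    and c: "c > 0"
  shows "bern_expect p (cross_pairs U V) (\<lambda>T. of_bool (real (card (cross_pairs K I \<inter> T)) < c)) \<ge>
    1 - p * real (card K * card I) / c"
proof -
  have fKI: "finite K" "finite I" using fin KI finite_subset by blast+
  have "bern_expect p (cross_pairs U V) (\<lambda>T. of_bool (c \<le> real (card (cross_pairs K I \<inter> T)))) \<le>
      bern_expect p (cross_pairs U V) (\<lambda>T. real (card (cross_pairs K I \<inter> T))) / c"
    by (rule bern_expect_Markov[OF p c]) auto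
  also have "\<dots> = p * real (card K * card I) / c"
    using fin fKI KI by (subst bern_expect_card_Int) (auto simp: cross_pairs_mono card_cross_pairs)
  finally have "bern_expect p (cross_pairs U V) (\<lambda>T. of_bool (\<not> (real (card (cross_pairs K I \<inter> T)) < c))) \<le>
      p * real (card K * card I) / c" by (simp add: not_less)
  then show ?thesis using fin by (subst (asm) bern_expect_compl) auto
qed

text \<open>Every discarded \<open>y\<close> is charged to one edge \<open>h y\<close> from
  \<open>K\<close> to \<open>y\<close>. As \<open>K\<close> and \<open>I\<close> are disjoint, the
  edge determines its endpoint in \<open>I\<close>, so no edge is charged twice.\<close>

lemma card_non_neighbours_ge:
  assumes "finite K" "finite I" "K \<inter> I = {}"
  shows "card I \<le> card {y \<in> I. \<forall>x\<in>K. {x, y} \<notin> T} + card (cross_pairs K I \<inter> T)"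
proof -
  let ?bad = "{y \<in> I. \<exists>x\<in>K. {x, y} \<in> T}"
  define h where "h y = {SOME x. x \<in> K \<and> {x, y} \<in> T, y}" for y
  have h: "\<exists>x\<in>K. {x, y} \<in> T \<and> h y = {x, y}" if "y \<in> ?bad" for y
    using that someI_ex[of "\<lambda>x. x \<in> K \<and> {x, y} \<in> T"] by (auto simp: h_def)
  have "inj_on h ?bad"
  proof (rule inj_onI)
    fix y z assume yz: "y \<in> ?bad" "z \<in> ?bad" "h y = h z"
    obtain a b where "a \<in> K" "h y = {a, y}" "b \<in> K" "h z = {b, z}" using h[OF yz(1)] h[OF yz(2)] by auto
    then show "y = z" using yz assms(3) by (auto simp: doubleton_eq_iff)
  qed
  moreover have "h ` ?bad \<subseteq> cross_pairs K I \<inter> T"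
  proof
    fix e assume "e \<in> h ` ?bad"
    then obtain y where y: "y \<in> ?bad" "e = h y" by auto
    obtain x where "x \<in> K" "{x, y} \<in> T" "h y = {x, y}" using h[OF y(1)] by auto
    then show "e \<in> cross_pairs K I \<inter> T" using y by (auto simp: cross_pairs_def)
  qed
  ultimately have "card ?bad \<le> card (cross_pairs K I \<inter> T)"
    using assms by (intro card_inj_on_le[of h]) auto
  moreover have "card I \<le> card ({y \<in> I. \<forall>x\<in>K. {x, y} \<notin> T} \<union> ?bad)"
    using assms by (intro card_mono) auto
  then have "card I \<le> card {y \<in> I. \<forall>x\<in>K. {x, y} \<notin> T} + card ?bad"
    using card_Un_le order_trans by blast
  ultimately show ?thesis by linarith
qed

subsection \<open>A clique with isolated vertices as a diameter graph\<close>

text \<open>Taking \<open>d + 1\<close> unit vectors would need dimension \<open>d + 1\<close>. In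
  dimension \<open>d\<close>, the \<open>d\<close> unit vectors are completed by a point on the
  diagonal.\<close>

lemma regular_simplex_exists:
  obtains X :: "(real ^ 'd::finite) set"
  where "finite X" "card X = CARD('d) + 1" "\<And>x y. x \<in> X \<Longrightarrow> y \<in> X \<Longrightarrow> x \<noteq> y \<Longrightarrow> dist x y = sqrt 2"
proof -
  let ?n = "real CARD('d)"
  have n: "?n > 0" by simp
  \<comment> \<open>The point \<open>(c, \<dots>, c)\<close> is at distance \<open>sqrt 2\<close> from every unit vector iff \<open>n c\<^sup>2 - 2 c = 1\<close>.\<close>
  define c where "c = (1 + sqrt (1 + ?n)) / ?n"
  define e :: "'d \<Rightarrow> real ^ 'd" where "e i = axis i 1" for i
  define z :: "real ^ 'd" where "z = (\<chi> i. c)"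
  have "?n * c = 1 + sqrt (1 + ?n)" by (simp add: c_def)
  then have "(?n * c - 1)\<^sup>2 = 1 + ?n" by simp
  then have "?n * (?n * c\<^sup>2 - 2 * c - 1) = 0" by (simp add: power2_eq_square algebra_simps)
  then have c: "?n * c\<^sup>2 - 2 * c = 1" using n by simp
  have ee: "e i \<bullet> e j = of_bool (i = j)" for i j by (simp add: e_def inner_axis_axis)
  have ze: "z \<bullet> e i = c" for i by (simp add: e_def z_def inner_axis)
  have zz: "z \<bullet> z = ?n * c\<^sup>2" by (simp add: z_def inner_vec_def power2_eq_square)
  have sq: "dist x y = sqrt (x \<bullet> x - 2 * (x \<bullet> y) + y \<bullet> y)" for x y :: "real ^ 'd"
    by (simp add: dist_norm norm_eq_sqrt_inner inner_diff inner_commute)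
  have de: "dist (e i) (e j) = sqrt 2" if "i \<noteq> j" for i j using that by (simp add: sq ee)
  have dz: "dist z (e i) = sqrt 2" for i
  proof -
    have "z \<bullet> z - 2 * (z \<bullet> e i) + e i \<bullet> e i = 2" using c by (simp add: ee ze zz)
    then show ?thesis by (simp add: sq)
  qed
  have inj: "inj e"
  proof (rule injI)
    fix i j assume "e i = e j" then show "i = j" using de[of i j] by (cases "i = j") auto
  qed
  have z: "z \<notin> range e"
  proof
    assume "z \<in> range e"
    then obtain i where "z = e i" by blast
    then show False using dz[of i] by simp
  qed
  show thesis
  proof (rule that[of "insert z (range e)"])
    show "card (insert z (range e)) = CARD('d) + 1" using z inj by (simp add: card_image)
    show "dist x y = sqrt 2" if "x \<in> insert z (range e)" "y \<in> insert z (range e)" "x \<noteq> y" for x y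
      using that de dz by (auto simp: dist_commute) (metis de)
  qed simp
qed

text \<open>The midpoint of an edge of the simplex has distance less than the side length to every vertex,
  so a small neighbourhood of it has room for all isolated vertices.\<close>

lemma infinite_near_vertices:
  fixes X :: "(real ^ 'd::finite) set"
  assumes X: "finite X" "card X \<ge> 2" "\<And>x y. x \<in> X \<Longrightarrow> y \<in> X \<Longrightarrow> x \<noteq> y \<Longrightarrow> dist x y = D" and D: "D > 0"
  obtains Y where "infinite Y" "Y \<inter> X = {}"
    "\<And>y x. y \<in> Y \<Longrightarrow> x \<in> X \<Longrightarrow> dist x y < D" "\<And>y y'. y \<in> Y \<Longrightarrow> y' \<in> Y \<Longrightarrow> dist y y' < D"
proof -
  obtain u v where uv: "u \<in> X" "v \<in> X" "u \<noteq> v"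
    using X by (metis card_le_Suc0_iff_eq not_less_eq_eq numeral_2_eq_2)
  define m where "m = midpoint u v"
  have duv: "dist u v = D" using X uv by auto
  have near: "dist x m < D" if x: "x \<in> X" for x
  proof (cases "x = u \<or> x = v")
    case True
    then show ?thesis using duv D by (auto simp: m_def dist_midpoint)
  next
    case False
    then have "dist x u = D" "dist x v = D" using X x uv by auto
    then show ?thesis using uv unfolding m_def
      using dist_decreases_open_segment by (metis duv linorder_not_less midpoint_in_open_segment order_less_imp_le)
  qed
  \<comment> \<open>The ball of radius \<open>D / 2\<close> keeps any two points of the region
    closer than \<open>D\<close>; the other balls do so for the distances to \<open>X\<close>. Being
    open and nonempty, the region is infinite.\<close>
  define O' where "O' = (\<Inter>x\<in>X. ball x D) \<inter> ball m (D / 2)"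
  have "open O'" unfolding O'_def using X by auto
  moreover have "m \<in> O'" using near D by (auto simp: O'_def)
  ultimately have "infinite O'" using finite_imp_not_open by blast
  show thesis
  proof (rule that[of "O' - X"])
    show "infinite (O' - X)" using \<open>infinite O'\<close> X by simp
    show "dist x y < D" if "y \<in> O' - X" "x \<in> X" for y x using that by (auto simp: O'_def)
    show "dist y y' < D" if "y \<in> O' - X" "y' \<in> O' - X" for y y'
      using that dist_triangle_half_r[of m y D y'] by (auto simp: O'_def)
  qed auto
qed

lemma clique_plus_isolated_is_diameter_graph:
  assumes K: "finite K" "card K = CARD('d) + 1" and J: "finite J" "K \<inter> J = {}"
    and E: "\<And>x y. x \<in> K \<union> J \<Longrightarrow> y \<in> K \<union> J \<Longrightarrow> x \<noteq> y \<Longrightarrow> {x, y} \<in> E \<longleftrightarrow> x \<in> K \<and> y \<in> K"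
  shows "is_diameter_graph TYPE('d::finite) (K \<union> J) E"
proof -
  obtain X :: "(real ^ 'd) set" where X: "finite X" "card X = CARD('d) + 1"
    "\<And>x y. x \<in> X \<Longrightarrow> y \<in> X \<Longrightarrow> x \<noteq> y \<Longrightarrow> dist x y = sqrt 2"
    using regular_simplex_exists by blast
  have cX: "card X \<ge> 2" using X(2) zero_less_card_finite[where 'a = 'd] by linarith
  obtain Y where Y: "infinite Y" "Y \<inter> X = {}"
    "\<And>y x. y \<in> Y \<Longrightarrow> x \<in> X \<Longrightarrow> dist x y < sqrt 2" "\<And>y y'. y \<in> Y \<Longrightarrow> y' \<in> Y \<Longrightarrow> dist y y' < sqrt 2"
    by (rule infinite_near_vertices[OF X(1) cX, of "sqrt 2"]) (use X(3) in auto)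
  obtain g where g: "bij_betw g K X" using K X finite_same_card_bij by metis
  obtain Y' where Y': "Y' \<subseteq> Y" "finite Y'" "card Y' = card J" using infinite_arbitrarily_large[OF Y(1)] by metis
  obtain h where h: "bij_betw h J Y'" using J Y' finite_same_card_bij by metis
  define f where "f x = (if x \<in> K then g x else h x)" for x
  have fK: "f x \<in> X" if "x \<in> K" for x using that g by (auto simp: f_def bij_betw_def)
  have fJ: "f x \<in> Y" if "x \<in> J" for x using that h J(2) Y'(1) by (auto simp: f_def bij_betw_def)
  have inj: "inj_on f (K \<union> J)"
  proof (rule inj_onI)
    fix x y assume xy: "x \<in> K \<union> J" "y \<in> K \<union> J" "f x = f y"
    have iff: "x \<in> K \<longleftrightarrow> y \<in> K" using xy fK fJ Y(2) by (metis Un_iff disjoint_iff)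
    show "x = y"
    proof (cases "x \<in> K")
      case True
      then show ?thesis using iff xy g by (auto simp: f_def bij_betw_def inj_on_def)
    next
      case False
      then show ?thesis using iff xy h by (auto simp: f_def bij_betw_def inj_on_def)
    qed
  qed
  have dKK: "dist (f x) (f y) = sqrt 2" if "x \<in> K" "y \<in> K" "x \<noteq> y" for x y
    using X(3)[OF fK[OF that(1)] fK[OF that(2)]] inj that by (auto simp: inj_on_def)
  have dlt: "dist (f x) (f y) < sqrt 2" if "x \<in> K \<union> J" "y \<in> K \<union> J" "\<not> (x \<in> K \<and> y \<in> K)" for x y
    using that fK fJ Y(3,4) by (auto simp: dist_commute) (metis dist_commute)+
  \<comment> \<open>Two clique vertices exist because the dimension is at least 1; without such a
    pair the distance \<open>sqrt 2\<close> would not be attained.\<close>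
  obtain a b where ab: "a \<in> K" "b \<in> K" "a \<noteq> b"
    using K cX X(2) by (metis card_le_Suc0_iff_eq not_less_eq_eq numeral_2_eq_2)
  have diam: "diam_fin (f ` (K \<union> J)) = sqrt 2"
    unfolding diam_fin_def
  proof (rule Max_eqI)
    have "{dist x y |x y. x \<in> f ` (K \<union> J) \<and> y \<in> f ` (K \<union> J)} = (\<lambda>(x, y). dist x y) ` (f ` (K \<union> J) \<times> f ` (K \<union> J))"
      by auto
    then show "finite {dist x y |x y. x \<in> f ` (K \<union> J) \<and> y \<in> f ` (K \<union> J)}" using K J by simp
    show "sqrt 2 \<in> {dist x y |x y. x \<in> f ` (K \<union> J) \<and> y \<in> f ` (K \<union> J)}"
      using dKK[OF ab] ab by (intro CollectI exI[of _ "f a"] exI[of _ "f b"]) auto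
    fix t assume "t \<in> {dist x y |x y. x \<in> f ` (K \<union> J) \<and> y \<in> f ` (K \<union> J)}"
    then obtain x y where xy: "x \<in> K \<union> J" "y \<in> K \<union> J" "t = dist (f x) (f y)" by blast
    show "t \<le> sqrt 2"
    proof (cases "x \<in> K \<and> y \<in> K")
      case True
      then show ?thesis using dKK[of x y] xy by (cases "x = y") auto
    next
      case False
      then show ?thesis using dlt[OF xy(1,2)] xy by simp
    qed
  qed
  show ?thesis
    unfolding is_diameter_graph_def
  proof (intro conjI exI[of _ f] ballI impI)
    show "finite (K \<union> J)" using K J by simp
    show "inj_on f (K \<union> J)" by (rule inj)
    fix x y assume xy: "x \<in> K \<union> J" "y \<in> K \<union> J" "x \<noteq> y"
    show "({x, y} \<in> E) = (dist (f x) (f y) = diam_fin (f ` (K \<union> J)))"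
    proof (cases "x \<in> K \<and> y \<in> K")
      case True
      then show ?thesis using E[OF xy] dKK[of x y] xy diam by simp
    next
      case False
      then show ?thesis using E[OF xy] dlt[OF xy(1,2)] diam by simp
    qed
  qed
qed

lemma clique_plus_isolated_chromatic_number:
  assumes K: "finite K" "card K = r" "0 < r"
    and E: "\<And>x y. x \<in> K \<union> J \<Longrightarrow> y \<in> K \<union> J \<Longrightarrow> x \<noteq> y \<Longrightarrow> {x, y} \<in> E \<longleftrightarrow> x \<in> K \<and> y \<in> K"
  shows "chromatic_number (K \<union> J) E = r"
  unfolding chromatic_number_def
proof (rule Least_equality)
  obtain g where g: "bij_betw g K {..<r}" using K finite_same_card_bij[of K "{..<r}"] by auto
  show "\<exists>c. (\<forall>x\<in>K \<union> J. c x < r) \<and> (\<forall>x\<in>K \<union> J. \<forall>y\<in>K \<union> J. {x, y} \<in> E \<longrightarrow> x \<noteq> y \<longrightarrow> c x \<noteq> c y)"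
  \<comment> \<open>Colour 0 is available since \<open>r > 0\<close>, and isolated vertices may
    share it with a clique vertex.\<close>
  proof (intro exI[of _ "\<lambda>x. if x \<in> K then g x else 0"] conjI ballI impI)
    fix x assume "x \<in> K \<union> J"
    then show "(if x \<in> K then g x else 0) < r" using g K by (auto simp: bij_betw_def)
  next
    fix x y assume xy: "x \<in> K \<union> J" "y \<in> K \<union> J" "{x, y} \<in> E" "x \<noteq> y"
    then have "x \<in> K" "y \<in> K" using E by auto
    then show "(if x \<in> K then g x else 0) \<noteq> (if y \<in> K then g y else 0)"
      using g xy by (auto simp: bij_betw_def inj_on_def)
  qed
next
  fix k assume "\<exists>c :: 'a \<Rightarrow> nat. (\<forall>x\<in>K \<union> J. c x < k) \<and> (\<forall>x\<in>K \<union> J. \<forall>y\<in>K \<union> J. {x, y} \<in> E \<longrightarrow> x \<noteq> y \<longrightarrow> c x \<noteq> c y)"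
  then obtain c :: "'a \<Rightarrow> nat" where c: "\<forall>x\<in>K \<union> J. c x < k"
    "\<forall>x\<in>K \<union> J. \<forall>y\<in>K \<union> J. {x, y} \<in> E \<longrightarrow> x \<noteq> y \<longrightarrow> c x \<noteq> c y" by (elim exE conjE)
  have "inj_on c K"
  proof (rule inj_onI, rule ccontr)
    fix x y assume xy: "x \<in> K" "y \<in> K" "c x = c y" "x \<noteq> y"
    then have "{x, y} \<in> E" using E[of x y] by simp
    then show False using c(2) xy by blast
  qed
  moreover have "c ` K \<subseteq> {..<k}" using c by auto
  ultimately show "r \<le> k" using card_inj_on_le[of c K "{..<k}"] K by simp
qed

section \<open>From clique and independent set to a lower bound for \<open>u_d\<close>\<close>

lemma event_u_if_clique_and_indep:
  assumes n: "U \<subseteq> {..<n}" "V \<subseteq> {..<n}" "U \<inter> V = {}"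
    and K: "K \<subseteq> U" "card K = CARD('d) + 1" "pairs_of K \<subseteq> R"
    and I: "I \<subseteq> V" "pairs_of I \<inter> S = {}"
    and RST: "R \<subseteq> pairs_of U" "S \<subseteq> pairs_of V" "T \<subseteq> cross_pairs U V"
    and few: "j + card (cross_pairs K I \<inter> T) \<le> card I"
  shows "event_u TYPE('d::finite) n (CARD('d) + 1 + j) (R \<union> S \<union> T)"
proof -
  have fK: "finite K" "finite I"
    using K(1) I(1) n finite_subset[of K "{..<n}"] finite_subset[of I "{..<n}"] by auto
  have KI: "K \<inter> I = {}" using K I n by auto
  let ?J = "{y \<in> I. \<forall>x\<in>K. {x, y} \<notin> T}"
  have "j \<le> card ?J" using card_non_neighbours_ge[OF fK KI, of T] few by linarith
  then obtain J where J: "J \<subseteq> ?J" "card J = j" using obtain_subset_with_card_n[of j ?J] by auto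
  have fJ: "finite J" using J fK finite_subset[of J I] by auto
  have KJ: "K \<inter> J = {}" using KI J by auto
  let ?E = "induced_edges (R \<union> S \<union> T) (K \<union> J)"
  have E: "{x, y} \<in> ?E \<longleftrightarrow> x \<in> K \<and> y \<in> K" if xy: "x \<in> K \<union> J" "y \<in> K \<union> J" "x \<noteq> y" for x y
  proof
    assume "x \<in> K \<and> y \<in> K"
    then have "{x, y} \<in> pairs_of K" using xy by (auto simp: pairs_of_def)
    then show "{x, y} \<in> ?E" using K xy by (auto simp: induced_edges_def)
  next
    assume "{x, y} \<in> ?E"
    then have xyE: "{x, y} \<in> R \<union> S \<union> T" by (simp add: induced_edges_def)
    \<comment> \<open>Among the chosen vertices, lying in \<open>U\<close> and lying in
      \<open>K\<close> are the same, so the position of an edge tells which of \<open>R\<close>,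
      \<open>S\<close> and \<open>T\<close> can contain it.\<close>
    have U: "x \<in> U \<longleftrightarrow> x \<in> K" "y \<in> U \<longleftrightarrow> y \<in> K" using xy K I J n by auto
    show "x \<in> K \<and> y \<in> K"
    proof (rule ccontr)
      assume neg: "\<not> (x \<in> K \<and> y \<in> K)"
      have "{x, y} \<notin> R" using neg RST(1) U by (auto simp: pairs_of_def)
      moreover have "{x, y} \<notin> S"
      proof
        assume "{x, y} \<in> S"
        then have "{x, y} \<in> pairs_of V" using RST by auto
        then have "x \<in> V" "y \<in> V" by (auto simp: pairs_of_def)
        then have "x \<in> J" "y \<in> J" using xy K n by auto
        then have "{x, y} \<in> pairs_of I" using xy J by (auto simp: pairs_of_def)
        then show False using I \<open>{x, y} \<in> S\<close> by auto
      qed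
      moreover have "{x, y} \<notin> T"
      proof
        assume T: "{x, y} \<in> T"
        then have "{x, y} \<in> cross_pairs U V" using RST by auto
        then have "(x \<in> U \<and> y \<in> V) \<or> (y \<in> U \<and> x \<in> V)"
          by (auto simp: cross_pairs_def doubleton_eq_iff)
        then have "(x \<in> K \<and> y \<in> J) \<or> (y \<in> K \<and> x \<in> J)" using U xy neg by auto
        then show False using J T by (auto simp: insert_commute)
      qed
      ultimately show False using xyE by blast
    qed
  qed
  have "card (K \<union> J) = CARD('d) + 1 + j" using fK fJ KJ K J by (simp add: card_Un_disjoint)
  moreover have "K \<union> J \<subseteq> {..<n}" using K J I n by auto
  moreover have "is_diameter_graph TYPE('d) (K \<union> J) ?E"
    by (rule clique_plus_isolated_is_diameter_graph[OF fK(1) K(2) fJ KJ E])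
  moreover have "chromatic_number (K \<union> J) ?E = CARD('d) + 1"
    by (rule clique_plus_isolated_chromatic_number[OF fK(1) K(2) _ E]) auto
  ultimately show ?thesis unfolding event_u_def by blast
qed

text \<open>\<open>Max\<close> is meaningful here because a size occurring with positive probability
  is at most \<open>n\<close>, which makes the set of admissible sizes finite.\<close>

lemma u_d_ge:
  assumes "0 < k" "prob_Gnp n p (event_u TYPE('d::finite) n k) > 1 / 2"
  shows "k \<le> u_d TYPE('d) n p"
proof -
  let ?S = "{k. 0 < k \<and> prob_Gnp n p (event_u TYPE('d) n k) > 1 / 2}"
  have "?S \<subseteq> {..n}"
  proof
    fix k assume "k \<in> ?S"
    then have "prob_Gnp n p (event_u TYPE('d) n k) \<noteq> 0" by auto
    then have "{E. E \<subseteq> all_edges n \<and> event_u TYPE('d) n k E} \<noteq> {}"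
      unfolding prob_Gnp_def by (metis sum.empty)
    then obtain W where "W \<subseteq> {..<n}" "card W = k" unfolding event_u_def by blast
    then show "k \<in> {..n}" using card_mono[of "{..<n}" W] by auto
  qed
  then have "finite ?S" using finite_subset by blast
  moreover have "k \<in> ?S" using assms by simp
  ultimately have "k \<le> Max ?S" by (rule Max_ge)
  moreover have "u_d TYPE('d) n p = Max ?S" unfolding u_d_def Let_def using \<open>k \<in> ?S\<close> by (metis empty_iff)
  ultimately show ?thesis by simp
qed

subsection \<open>Asymptotics\<close>

text \<open>Instantiates the second moment bound with \<open>k\<close> about
  \<open>a * ln n / p\<close> and \<open>L\<close> about \<open>n powr g\<close>. Since
  \<open>p\<close> is known only up to constants, the conditions are checked for explicit functions
  of \<open>n\<close> in \<open>ev1\<close> to \<open>ev5\<close> and then transferred by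
  monotonicity.\<close>

lemma indep_num_second_moment_eventually:
  fixes p :: "nat \<Rightarrow> real" and V :: "nat \<Rightarrow> nat set"
  assumes \<alpha>: "0 < \<alpha>" "\<alpha> < 1" and C: "0 < C" and a: "0 < a" "a < 2 - 2 * \<alpha>"
    and g: "2 * \<alpha> - 1 < g"
    and p: "\<forall>\<^sub>F n in sequentially. real n powr - \<alpha> < p n \<and> p n < C * real n powr - \<alpha>"
    and V: "\<And>n. finite (V n)" "\<And>n. real n / 2 \<le> real (card (V n))"
  shows "\<forall>\<^sub>F n in sequentially.
    1 \<le> bern_expect (p n) (pairs_of (V n)) (\<lambda>E. of_bool (a * ln (real n) / p n \<le> real (indep_num (V n) E))) *
      (exp (C * real n powr - \<alpha> * (real n powr g + 1)\<^sup>2) + 2 * (1 / 2) powr (real n powr g))"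
proof -
  \<comment> \<open>Here \<open>2 - 2 * \<alpha>\<close> enters:
    \<open>exp (\<theta> * k / 2)\<close> is about \<open>n powr (a / 2)\<close>, hence at most
    \<open>n powr b\<close> with room for lower order terms, and the other factors in
    \<open>large\<close> amount to \<open>n powr (\<alpha> - 1)\<close> up to logarithms.\<close>
  define b where "b = (a / 2 + (1 - \<alpha>)) / 2"
  have b: "a / 2 < b" "b < 1 - \<alpha>" using a by (auto simp: b_def field_simps)
  have ev1: "\<forall>\<^sub>F n in sequentially. C * real n powr - \<alpha> \<le> 1 / 2"
    using \<alpha> C by real_asymp
  have ev2: "\<forall>\<^sub>F n in sequentially. a * real n powr \<alpha> * ln (real n) + 1 \<le> real n / 2"
    using \<alpha> a(1) by real_asymp
  have ev3: "\<forall>\<^sub>F n in sequentially. exp 2 * (a * real n powr \<alpha> * ln (real n) + 1)\<^sup>2 /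
      (real n powr g * (real n / 2)) \<le> 1 / 2"
    using \<alpha> a(1) g by real_asymp
  have ev4: "\<forall>\<^sub>F n in sequentially. exp 1 * (a * real n powr \<alpha> * ln (real n) + 1)\<^sup>2 *
      (2 * C * real n powr - \<alpha>) / (real n / 2) * real n powr b \<le> 1"
    using \<alpha> a(1) C b by real_asymp
  have ev5: "\<forall>\<^sub>F n in sequentially. (a * ln (real n) + C * real n powr - \<alpha>) /
      (2 * (1 - C * real n powr - \<alpha>)) \<le> b * ln (real n)"
    using \<alpha> a(1) C b by real_asymp
  have ev6: "\<forall>\<^sub>F n in sequentially. n \<ge> 2" by (rule eventually_ge_at_top)
  show ?thesis
    using p ev1 ev2 ev3 ev4 ev5 ev6
  proof eventually_elim
    case (elim n)
    define x where "x = real n"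
    define q where "q = p n"
    define N where "N = card (V n)"
    define k where "k = nat \<lceil>a * ln x / q\<rceil>"
    define L where "L = nat \<lceil>x powr g\<rceil>"
    define \<theta> where "\<theta> = q / (1 - q)"
    \<comment> \<open>Upper bound for \<open>k\<close> that does not mention \<open>p\<close>,
      obtained from \<open>1 / p \<le> n powr \<alpha>\<close>.\<close>
    define M where "M = a * x powr \<alpha> * ln x + 1"
    have x: "x \<ge> 2" "ln x > 0" using elim by (auto simp: x_def)
    have q: "x powr - \<alpha> < q" "q < C * x powr - \<alpha>" "C * x powr - \<alpha> \<le> 1 / 2"
      using elim by (auto simp: x_def q_def)
    have "x powr - \<alpha> > 0" using x by simp
    then have q01: "0 < q" "q < 1 / 2" using q by linarith+
    have inv: "1 / q \<le> x powr \<alpha>" using q(1) q01 x by (simp add: powr_minus field_simps)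
    have N: "x / 2 \<le> real N" using V(2)[of n] by (simp add: x_def N_def)
    have pos: "0 < a * ln x / q" using a x q01 by simp
    have k: "a * ln x / q \<le> real k" "real k \<le> a * ln x / q + 1" "0 < k"
      using pos unfolding k_def by linarith+
    have "a * ln x / q = (a * ln x) * (1 / q)" by simp
    also have "\<dots> \<le> (a * ln x) * x powr \<alpha>" using a x by (intro mult_left_mono inv) auto
    finally have kM: "real k \<le> M" using k(2) by (simp add: M_def mult_ac)
    have kN: "k \<le> N" using kM N elim(3) by (simp add: M_def x_def)
    have L: "x powr g \<le> real L" "real L \<le> x powr g + 1" "0 < L"
    proof -
      have "0 < x powr g" using x by simp
      then show "x powr g \<le> real L" "real L \<le> x powr g + 1" "0 < L" unfolding L_def by linarith+
    qed
    have \<theta>: "0 \<le> \<theta>" "\<theta> \<le> 2 * C * x powr - \<alpha>"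
    proof -
      show "0 \<le> \<theta>" using q01 by (simp add: \<theta>_def)
      have "\<theta> \<le> q / (1 / 2)" unfolding \<theta>_def using q01 by (intro divide_left_mono) auto
      then show "\<theta> \<le> 2 * C * x powr - \<alpha>" using q by simp
    qed
    have M0: "0 \<le> M" using kM by (meson of_nat_0_le_iff order_trans)
    have sq: "real k ^ 2 \<le> M\<^sup>2" using kM by (intro power_mono) auto
    have small: "exp 2 * real k ^ 2 / (real L * real N) \<le> 1 / 2"
    proof -
      have "exp 2 * real k ^ 2 / (real L * real N) \<le> exp 2 * M\<^sup>2 / (x powr g * (x / 2))"
        using sq L N x by (intro frac_le mult_mono) auto
      also have "\<dots> \<le> 1 / 2" using elim(4) by (simp add: M_def x_def)
      finally show ?thesis .
    qed
    have "\<theta> * real k / 2 \<le> b * ln x"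
    proof -
      have "real k * q \<le> (a * ln x / q + 1) * q" using k q01 by (intro mult_right_mono) auto
      also have "\<dots> = a * ln x + q" using q01 by (simp add: field_simps)
      finally have kq: "real k * q \<le> a * ln x + C * x powr - \<alpha>" using q by linarith
      have "\<theta> * real k / 2 = real k * q / (2 * (1 - q))" by (simp add: \<theta>_def mult.commute)
      also have "\<dots> \<le> (a * ln x + C * x powr - \<alpha>) / (2 * (1 - C * x powr - \<alpha>))"
        using kq q q01 a x by (intro frac_le) auto
      also have "\<dots> \<le> b * ln x" using elim(6) by (simp add: x_def)
      finally show ?thesis .
    qed
    then have "exp (\<theta> * real k / 2) \<le> exp (b * ln x)" by simp
    also have "\<dots> = x powr b" using x by (simp add: powr_def)
    finally have ex: "exp (\<theta> * real k / 2) \<le> x powr b" .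
    have large: "exp 1 * real k ^ 2 * \<theta> / real N * exp (\<theta> * real k / 2) \<le> 1"
    proof -
      have "exp 1 * real k ^ 2 * \<theta> / real N * exp (\<theta> * real k / 2) \<le>
          exp 1 * M\<^sup>2 * (2 * C * x powr - \<alpha>) / (x / 2) * x powr b"
        using sq \<theta> N x C by (intro mult_mono frac_le ex) auto
      also have "\<dots> \<le> 1" using elim(5) by (simp add: M_def x_def)
      finally show ?thesis .
    qed
    let ?P = "bern_expect q (pairs_of (V n)) (\<lambda>E. of_bool (a * ln x / q \<le> real (indep_num (V n) E)))"
    have "has_indep k (V n) E \<longleftrightarrow> a * ln x / q \<le> real (indep_num (V n) E)" for E
      unfolding has_indep_iff[OF V(1)] k_def by (simp add: nat_le_iff ceiling_le_iff)
    then have "1 \<le> ?P * (exp (\<theta> * real L ^ 2 / 2) + 2 * (1 / 2) ^ L)"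
      using has_indep_prob_ge[of q "V n" N k L] q01 V(1) k(3) kN L(3) small large
      by (simp add: N_def \<theta>_def)
    also have "\<dots> \<le> ?P * (exp (C * x powr - \<alpha> * (x powr g + 1)\<^sup>2) + 2 * (1 / 2) powr (x powr g))"
    proof (intro mult_left_mono add_mono)
      have "\<theta> * real L ^ 2 / 2 \<le> (2 * C * x powr - \<alpha>) * (x powr g + 1)\<^sup>2 / 2"
        using \<theta> L C by (intro divide_right_mono mult_mono power_mono) auto
      then show "exp (\<theta> * real L ^ 2 / 2) \<le> exp (C * x powr - \<alpha> * (x powr g + 1)\<^sup>2)" by simp
      have "(1 / 2 :: real) ^ L = (1 / 2) powr real L" by (simp add: powr_realpow)
      also have "\<dots> \<le> (1 / 2) powr (x powr g)" using L by (intro powr_mono') auto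
      finally show "(1 / 2 :: real) ^ L \<le> (1 / 2) powr (x powr g)" .
      show "0 \<le> ?P" using q01 V(1) by (intro bern_expect_ge_const) auto
    qed auto
    finally show ?case by (simp add: x_def q_def)
  qed
qed

text \<open>For \<open>\<alpha> < 3/5\<close> the second moment method alone succeeds with high probability. For larger \<open>\<alpha>\<close> it
  only gives probability at least \<open>exp (- n powr (3 * \<alpha> - 2 + o(1)))\<close>, which still beats the deviation
  probability \<open>exp (- n powr (2 * \<alpha> - 1 + o(1)))\<close> from bounded differences, because \<open>\<alpha> < 1\<close>.\<close>

lemma indep_num_ge_eventually:
  fixes p :: "nat \<Rightarrow> real" and V :: "nat \<Rightarrow> nat set"
  assumes \<alpha>: "0 < \<alpha>" "\<alpha> < 1" and C: "0 < C" and a: "0 < a" "a < 2 - 2 * \<alpha>"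
    and p: "\<forall>\<^sub>F n in sequentially. real n powr - \<alpha> < p n \<and> p n < C * real n powr - \<alpha>"
    and V: "\<And>n. finite (V n)" "\<And>n. real n / 2 \<le> real (card (V n))" "\<And>n. card (V n) \<le> n"
  shows "\<forall>\<^sub>F n in sequentially.
    9 / 10 \<le> bern_expect (p n) (pairs_of (V n)) (\<lambda>E. of_bool (a * ln (real n) / p n \<le> real (indep_num (V n) E)))"
proof (cases "\<alpha> < 3 / 5")
  case True
  \<comment> \<open>Wanted is \<open>2 * \<alpha> - 1 < g < \<alpha> / 2\<close>, the upper bound
    making \<open>p * L^2\<close> vanish; \<open>\<alpha> / 3\<close> qualifies exactly for \<alpha>
    < 3/5.\<close>
  define g where "g = \<alpha> / 3"
  have g: "0 < g" "2 * \<alpha> - 1 < g" "2 * g < \<alpha>" using True \<alpha> by (auto simp: g_def)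
  have ev1: "\<forall>\<^sub>F n in sequentially. exp (C * real n powr - \<alpha> * (real n powr g + 1)\<^sup>2) +
      2 * (1 / 2) powr (real n powr g) \<le> 10 / 9"
    using \<alpha> C g by real_asymp
  have ev2: "\<forall>\<^sub>F n in sequentially. C * real n powr - \<alpha> \<le> 1"
    using \<alpha> C by real_asymp
  show ?thesis
    using indep_num_second_moment_eventually[OF \<alpha> C a g(2) p V(1,2)] ev1 ev2 p
  proof eventually_elim
    case (elim n)
    let ?P = "bern_expect (p n) (pairs_of (V n)) (\<lambda>E. of_bool (a * ln (real n) / p n \<le> real (indep_num (V n) E)))"
    have "0 \<le> p n" using elim(4) powr_ge_zero[of "real n" "- \<alpha>"] by linarith
    moreover have "p n \<le> 1" using elim by linarith
    ultimately have "0 \<le> ?P" using V(1) by (intro bern_expect_ge_const) auto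
    then have "?P * (exp (C * real n powr - \<alpha> * (real n powr g + 1)\<^sup>2) + 2 * (1 / 2) powr (real n powr g)) \<le>
        ?P * (10 / 9)" using elim by (intro mult_left_mono)
    then show ?case using elim(1) by linarith
  qed
next
  case False
  \<comment> \<open>Midpoint of \<open>2 * \<alpha> - 1\<close> and
    \<open>(3 * \<alpha> - 1) / 2\<close>. Below the latter, the second moment loss
    \<open>n powr (2 * g - \<alpha>)\<close> stays under the concentration exponent
    \<open>n powr (2 * \<alpha> - 1)\<close>; the interval is nonempty because \<alpha> < 1.\<close>
  define g where "g = (7 * \<alpha> - 3) / 4"
  have g: "0 < g" "2 * \<alpha> - 1 < g" "2 * g - \<alpha> < 2 * \<alpha> - 1" "1 < 2 * \<alpha>"
    using False \<alpha> by (auto simp: g_def field_simps)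
  define a' where "a' = (a + (2 - 2 * \<alpha>)) / 2"
  have a': "a < a'" "0 < a'" "a' < 2 - 2 * \<alpha>" using a by (auto simp: a'_def)
  \<comment> \<open>With \<open>1 / p \<ge> n powr \<alpha> / C\<close>, the gap between the sizes
    for \<open>a'\<close> and \<open>a\<close> is at least
    \<open>c * n powr \<alpha> * ln n\<close>.\<close>
  define c where "c = (a' - a) / C"
  have c: "c > 0" using a' C by (simp add: c_def)
  have ev1: "\<forall>\<^sub>F n in sequentially. 3 * exp (C * real n powr - \<alpha> * (real n powr g + 1)\<^sup>2 -
      (c * real n powr \<alpha> * ln (real n))\<^sup>2 / (8 * real n)) \<le> 1 / 11"
    using \<alpha> C g c by real_asymp
  have ev2: "\<forall>\<^sub>F n in sequentially. C * real n powr - \<alpha> \<le> 1"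
    using \<alpha> C by real_asymp
  have ev3: "\<forall>\<^sub>F n in sequentially. c * real n powr \<alpha> * ln (real n) \<le> 4 * real n"
    using \<alpha> c by real_asymp
  have ev4: "\<forall>\<^sub>F n in sequentially. n \<ge> 2" by (rule eventually_ge_at_top)
  show ?thesis
    using indep_num_second_moment_eventually[OF \<alpha> C a'(2,3) g(2) p V(1,2)] ev1 ev2 ev3 ev4 p
  proof eventually_elim
    case (elim n)
    define x where "x = real n"
    define q where "q = p n"
    define D where "D = c * x powr \<alpha> * ln x"
    \<comment> \<open>The minimiser of \<open>2 * s^2 * x - s * D\<close>, with minimum
      \<open>- D^2 / (8 * x)\<close>.\<close>
    define s where "s = D / (4 * x)"
    define T where "T = C * x powr - \<alpha> * (x powr g + 1)\<^sup>2"
    let ?f = "\<lambda>E. real (indep_num (V n) E)"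
    let ?E = "bern_expect q (pairs_of (V n))"
    let ?hi = "?E (\<lambda>E. of_bool (a' * ln x / q \<le> ?f E))"
    let ?lo = "?E (\<lambda>E. of_bool (?f E \<le> a * ln x / q))"
    have x: "x \<ge> 2" "ln x > 0" using elim by (auto simp: x_def)
    have q: "x powr - \<alpha> < q" "q < C * x powr - \<alpha>" using elim by (auto simp: x_def q_def)
    have "x powr - \<alpha> > 0" using x by simp
    then have q01: "0 < q" "q \<le> 1" using q elim(3)[folded x_def] by linarith+
    have D0: "D > 0" using c x by (simp add: D_def)
    have s: "0 < s" "s \<le> 1" using D0 x elim(4) by (simp_all add: s_def D_def x_def)
    have Dle: "D \<le> a' * ln x / q - a * ln x / q"
    proof -
      have "x powr \<alpha> / C \<le> 1 / q" using q q01 C x by (simp add: powr_minus field_simps)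
      then have "((a' - a) * ln x) * (x powr \<alpha> / C) \<le> ((a' - a) * ln x) * (1 / q)"
        using a' x by (intro mult_left_mono) auto
      then have "D \<le> (a' - a) * ln x * (1 / q)" by (simp add: D_def c_def mult_ac)
      also have "\<dots> = a' * ln x / q - a * ln x / q" by (simp add: algebra_simps diff_divide_distrib)
      finally show ?thesis .
    qed
    have lo0: "0 \<le> ?lo" using q01 V(1) by (intro bern_expect_ge_const) auto
    have "2 * s\<^sup>2 * real (card (V n)) - s * (a' * ln x / q - a * ln x / q) \<le> 2 * s\<^sup>2 * x - s * D"
      using V(3)[of n] Dle s by (intro diff_mono mult_left_mono) (auto simp: x_def)
    also have "\<dots> = - (D\<^sup>2 / (8 * x))" using x by (simp add: s_def power2_eq_square field_simps)
    finally have conc: "?lo * ?hi \<le> exp (- (D\<^sup>2 / (8 * x)))"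
      using indep_num_concentration[OF less_imp_le[OF q01(1)] q01(2) V(1)[of n] s, of "a * ln x / q" "a' * ln x / q"]
      by (meson exp_le_cancel_iff order_trans)
    have "1 \<le> ?hi * (exp T + 2 * (1 / 2) powr (x powr g))"
      using elim(1) by (simp add: x_def q_def T_def)
    also have "\<dots> \<le> ?hi * (3 * exp T)"
    proof (intro mult_left_mono)
      have "(1 / 2 :: real) powr (x powr g) \<le> (1 / 2) powr 0" by (intro powr_mono') auto
      then have "(1 / 2 :: real) powr (x powr g) \<le> 1" by simp
      moreover have "1 \<le> exp T" using C by (simp add: T_def)
      ultimately show "exp T + 2 * (1 / 2) powr (x powr g) \<le> 3 * exp T" by linarith
      show "0 \<le> ?hi" using q01 V(1) by (intro bern_expect_ge_const) auto
    qed
    \<comment> \<open>Multiplying by \<open>?lo\<close> creates the product \<open>?lo * ?hi\<close>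
      that concentration bounds: since \<open>?hi\<close> is not too small, \<open>?lo\<close> must
      be tiny.\<close>
    finally have "?lo * 1 \<le> ?lo * (?hi * (3 * exp T))" using lo0 by (intro mult_left_mono)
    also have "\<dots> = (?lo * ?hi) * (3 * exp T)" by simp
    also have "\<dots> \<le> exp (- (D\<^sup>2 / (8 * x))) * (3 * exp T)" using conc by (intro mult_right_mono) auto
    also have "\<dots> = 3 * exp (T - D\<^sup>2 / (8 * x))" by (simp add: exp_diff exp_minus field_simps)
    also have "\<dots> \<le> 1 / 11" using elim(2) by (simp add: T_def D_def x_def)
    finally have "?lo \<le> 1 / 10" by simp
    moreover have "?E (\<lambda>E. of_bool (\<not> (a * ln x / q \<le> ?f E))) \<le> ?lo"
      using q01 by (intro bern_expect_mono) auto
    ultimately have "?E (\<lambda>E. of_bool (a * ln x / q \<le> ?f E)) \<ge> 9 / 10"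
      using V(1) by (subst (asm) bern_expect_compl) auto
    then show ?case by (simp add: x_def q_def)
  qed
qed

text \<open>The hardest extension is the last one, from \<open>d\<close> to \<open>d + 1\<close>
  vertices: all failure terms are bounded by the one with \<open>p ^ d\<close>, and
  \<open>m * p ^ d\<close> grows at least like \<open>n powr \<beta>\<close> with \<beta> >
  0.\<close>

lemma has_clique_prob_eventually:
  fixes p :: "nat \<Rightarrow> real"
  assumes \<alpha>: "0 < \<alpha>" "\<alpha> * real d < 1"
    and p: "\<forall>\<^sub>F n in sequentially. real n powr - \<alpha> < p n \<and> p n \<le> 1"
    and m: "\<And>n. m n = n div (2 * (d + 1))"
  shows "\<forall>\<^sub>F n in sequentially. 9 / 10 \<le>
    bern_expect (p n) (pairs_of {..<(d + 1) * m n}) (\<lambda>E. of_bool (has_clique (d + 1) {..<(d + 1) * m n} E))"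
proof -
  define r where "r = real (d + 1)"
  define \<beta> where "\<beta> = 1 - \<alpha> * real d"
  have r: "r > 0" and \<beta>: "\<beta> > 0" using \<alpha> by (auto simp: r_def \<beta>_def)
  have ev: "\<forall>\<^sub>F n in sequentially. r * exp (- (real n / (2 * r) - 1) * real n powr (\<beta> - 1)) \<le> 1 / 10"
    using r \<beta> by real_asymp
  have ev1: "\<forall>\<^sub>F n in sequentially. n \<ge> 1" by (rule eventually_ge_at_top)
  show ?thesis
    using p ev ev1
  proof eventually_elim
    case (elim n)
    have x: "real n powr - \<alpha> > 0" using elim by simp
    then have p01: "0 \<le> p n" "p n \<le> 1" using elim by linarith+
    have "n < 2 * (d + 1) * (m n + 1)"
      unfolding m using dividend_less_times_div[of "2 * (d + 1)" n] by (simp add: algebra_simps)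
    then have "real n < real (2 * (d + 1) * (m n + 1))" by (simp only: of_nat_less_iff)
    then have "real n < 2 * r * (real (m n) + 1)" by (simp add: r_def algebra_simps)
    then have mr: "real n / (2 * r) - 1 \<le> real (m n)" using r by (simp add: field_simps)
    have le: "exp (- real (m n) * p n ^ i) \<le> exp (- (real n / (2 * r) - 1) * real n powr (\<beta> - 1))" if "i < d + 1" for i
    proof -
      have "real n powr (\<beta> - 1) = (real n powr - \<alpha>) ^ d"
        using x by (simp add: \<beta>_def powr_powr flip: powr_realpow)
      also have "\<dots> \<le> p n ^ d" using elim x by (intro power_mono) auto
      also have "\<dots> \<le> p n ^ i" using p01 that by (intro power_decreasing) auto
      finally have pi: "real n powr (\<beta> - 1) \<le> p n ^ i" .
      have "(real n / (2 * r) - 1) * real n powr (\<beta> - 1) \<le> real (m n) * real n powr (\<beta> - 1)"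
        using mr by (intro mult_right_mono) auto
      also have "\<dots> \<le> real (m n) * p n ^ i" using pi by (intro mult_left_mono) auto
      finally show ?thesis by (simp only: exp_le_cancel_iff mult_minus_left neg_le_iff_le)
    qed
    have "(\<Sum>i<d + 1. exp (- real (m n) * p n ^ i)) \<le>
        (\<Sum>i<d + 1. exp (- (real n / (2 * r) - 1) * real n powr (\<beta> - 1)))"
      using le by (intro sum_mono) auto
    also have "\<dots> \<le> 1 / 10" using elim(2) by (simp add: r_def)
    finally show ?case using has_clique_prob[OF p01, where r = "d + 1" and m = "m n"] by linarith
  qed
qed

theorem theorem25:
  fixes p :: "nat \<Rightarrow> real" and \<alpha> C :: real
  assumes "0 < \<alpha>" and "\<alpha> < 1 / real CARD('d::finite)" and "C > 0"
    and "\<forall>\<^sub>F n in sequentially. 1 < p n * real n powr \<alpha> \<and> p n * real n powr \<alpha> < C"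
  shows "\<forall>\<epsilon>>0. \<exists>n0. \<forall>n\<ge>n0.
           real (u_d TYPE('d) n (p n)) \<ge> (2 - 2 * \<alpha> - \<epsilon>) * ln (real n) / p n"
proof (intro allI impI)
  fix \<epsilon> :: real assume \<epsilon>: "\<epsilon> > 0"
  define d where "d = CARD('d)"
  \<comment> \<open>The maximum keeps \<open>a\<close> positive for large \<epsilon>, and
    \<open>1 - \<alpha>\<close> is still below \<open>2 - 2 * \<alpha>\<close>.\<close>
  define a where "a = max (2 - 2 * \<alpha> - \<epsilon>) (1 - \<alpha>)"
  define a' where "a' = (a + (2 - 2 * \<alpha>)) / 2"
  \<comment> \<open>The share of the independent set that may be discarded. By this choice
    \<open>(1 - \<delta>) * a'\<close> is the midpoint of \<open>a\<close> and \<open>a'\<close>,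
    and the surplus over \<open>a\<close> absorbs the rounding in \<open>j\<close>.\<close>
  define \<delta> where "\<delta> = (a' - a) / (2 * a')"
  \<comment> \<open>The \<open>d + 1\<close> blocks of size \<open>m n\<close> fill at most half of
    the vertices, so \<open>V n\<close> keeps at least \<open>n / 2\<close> of them.\<close>
  define m where "m n = n div (2 * (d + 1))" for n
  define U where "U n = {..<(d + 1) * m n}" for n
  define V where "V n = {(d + 1) * m n..<n}" for n
  have d: "d \<ge> 1" unfolding d_def using zero_less_card_finite[where 'a = 'd] by linarith
  have \<alpha>d: "\<alpha> * real d < 1" using assms(2) d by (simp add: d_def field_simps)
  moreover have "\<alpha> * 1 \<le> \<alpha> * real d" using assms(1) d by (intro mult_left_mono) auto
  ultimately have \<alpha>1: "\<alpha> < 1" by simp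
  have a: "0 < a" "a < a'" "0 < a'" "a' < 2 - 2 * \<alpha>" "2 - 2 * \<alpha> - \<epsilon> \<le> a"
    using \<alpha>1 \<epsilon> by (auto simp: a_def a'_def)
  have \<delta>: "0 < \<delta>" "(1 - \<delta>) * a' = (a + a') / 2" using a by (auto simp: \<delta>_def field_simps)
  have m2: "2 * ((d + 1) * m n) \<le> n" for n
    using div_times_less_eq_dividend[of n "2 * (d + 1)"] unfolding m_def by (simp add: mult_ac)
  have UV: "finite (U n)" "finite (V n)" "U n \<inter> V n = {}" "U n \<union> V n = {..<n}" for n
    using m2[of n] by (auto simp: U_def V_def)
  have cV: "real n / 2 \<le> real (card (V n))" "card (V n) \<le> n" for n
  proof -
    have "n \<le> 2 * card (V n)" using m2[of n] by (simp add: V_def)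
    then show "real n / 2 \<le> real (card (V n))" by linarith
    show "card (V n) \<le> n" by (simp add: V_def)
  qed
  have ev1: "\<forall>\<^sub>F n in sequentially. n \<ge> 2" by (rule eventually_ge_at_top)
  have p: "\<forall>\<^sub>F n in sequentially. real n powr - \<alpha> < p n \<and> p n < C * real n powr - \<alpha>"
    using assms(4) ev1 by eventually_elim (auto simp: powr_minus field_simps)
  have ev2: "\<forall>\<^sub>F n in sequentially. C * real n powr - \<alpha> \<le> 1" using assms(1,3) by real_asymp
  have p1: "\<forall>\<^sub>F n in sequentially. real n powr - \<alpha> < p n \<and> p n \<le> 1"
    using p ev2 by eventually_elim linarith
  have ev3: "\<forall>\<^sub>F n in sequentially. C * real n powr - \<alpha> * real (d + 1) / \<delta> \<le> 1 / 10"
    using assms(1,3) \<delta> by real_asymp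
  have ev4: "\<forall>\<^sub>F n in sequentially. 1 \<le> (a' - a) / 2 * ln (real n)"
    using a by real_asymp
  have "\<forall>\<^sub>F n in sequentially. (2 - 2 * \<alpha> - \<epsilon>) * ln (real n) / p n \<le> real (u_d TYPE('d) n (p n))"
    using has_clique_prob_eventually[OF assms(1) \<alpha>d p1 m_def]
      indep_num_ge_eventually[OF assms(1) \<alpha>1 assms(3) a(3,4) p UV(2) cV] p p1 ev1 ev3 ev4
  proof eventually_elim
    case (elim n)
    define q where "q = p n"
    define j where "j = nat \<lceil>a * ln (real n) / q\<rceil>"
    let ?k = "d + 1 + j"
    have q: "0 < q" "q \<le> 1" using elim(4) powr_ge_zero[of "real n" "- \<alpha>"] unfolding q_def by linarith+
    have ln0: "ln (real n) > 0" using elim by simp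
    have j: "a * ln (real n) / q \<le> real j" "real j \<le> a * ln (real n) / q + 1"
      using a ln0 q divide_pos_pos[of "a * ln (real n)" q] unfolding j_def by (auto simp: of_nat_ceiling)
    let ?P = "has_clique (d + 1) (U n)" and ?Q = "\<lambda>S. a' * ln (real n) / q \<le> real (indep_num (V n) S)"
    have "bern_expect q (pairs_of (U n)) (\<lambda>R. of_bool (?P R)) *
        bern_expect q (pairs_of (V n)) (\<lambda>S. of_bool (?Q S)) * (9 / 10)
      \<le> bern_expect q (pairs_of (U n \<union> V n)) (\<lambda>E. of_bool (event_u TYPE('d) n ?k E))"
    proof (rule bern_expect_pairs_of_Un_cross_ge[OF _ q(2) UV(1-3)])
      fix R S assume RS: "R \<subseteq> pairs_of (U n)" "S \<subseteq> pairs_of (V n)" "?P R" "?Q S"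
      obtain K where K: "K \<subseteq> U n" "card K = d + 1" "pairs_of K \<subseteq> R" using RS(3) by (auto simp: has_clique_def)
      obtain I where I: "I \<subseteq> V n" "pairs_of I \<inter> S = {}" "card I = indep_num (V n) S"
        using indep_num_witness[OF UV(2)] .
      have Ige: "a' * ln (real n) / q \<le> real (card I)" using RS(4) I by simp
      moreover have "0 < a' * ln (real n) / q" using a ln0 q by simp
      ultimately have I0: "0 < real (card I)" by linarith
      have jI: "real j \<le> (1 - \<delta>) * real (card I)"
      proof -
        have "1 \<le> (a' - a) / 2 * ln (real n)" by (rule elim(7))
        also have "\<dots> \<le> (a' - a) / 2 * ln (real n) / q"
          using q a ln0 divide_left_mono[of q 1 "(a' - a) / 2 * ln (real n)"] by simp
        finally have "real j \<le> a * ln (real n) / q + (a' - a) / 2 * ln (real n) / q" using j by linarith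
        also have "\<dots> = (a + a') / 2 * ln (real n) / q"
          using q by (simp add: field_simps)
        also have "\<dots> = (1 - \<delta>) * (a' * ln (real n) / q)" unfolding \<delta>(2)[symmetric] by simp
        also have "\<dots> \<le> (1 - \<delta>) * real (card I)"
          using Ige a by (intro mult_left_mono) (auto simp: \<delta>_def field_simps)
        finally show ?thesis .
      qed
      \<comment> \<open>The size of \<open>I\<close> cancels, so the failure bound
        \<open>q * (d + 1) / \<delta>\<close> is the same for all outcomes \<open>R\<close> and
        \<open>S\<close> and tends to 0.\<close>
      have "9 / 10 \<le> 1 - q * real (card K * card I) / (\<delta> * real (card I))"
      proof -
        have "q * real (card K * card I) / (\<delta> * real (card I)) = q * real (d + 1) / \<delta>"
          using I0 \<delta>(1) K(2) by (simp add: divide_simps) (simp add: algebra_simps)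
        also have "\<dots> \<le> C * real n powr - \<alpha> * real (d + 1) / \<delta>"
          using elim(3) \<delta> by (intro divide_right_mono mult_right_mono) (auto simp: q_def)
        finally show ?thesis using elim(6) by linarith
      qed
      also have "\<dots> \<le> bern_expect q (cross_pairs (U n) (V n))
          (\<lambda>T. of_bool (real (card (cross_pairs K I \<inter> T)) < \<delta> * real (card I)))"
        using q UV(1,2,3)[of n] K(1) I(1) I0 \<delta>(1) by (intro few_cross_edges_prob) auto
      also have "\<dots> \<le> bern_expect q (cross_pairs (U n) (V n)) (\<lambda>T. of_bool (event_u TYPE('d) n ?k (R \<union> S \<union> T)))"
      proof (intro bern_expect_mono)
        fix T assume T: "T \<subseteq> cross_pairs (U n) (V n)"
        have "event_u TYPE('d) n ?k (R \<union> S \<union> T)" if "real (card (cross_pairs K I \<inter> T)) < \<delta> * real (card I)"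
        proof -
          have "real j + real (card (cross_pairs K I \<inter> T)) \<le> real (card I)"
            using jI that by (simp add: algebra_simps)
          then have few: "j + card (cross_pairs K I \<inter> T) \<le> card I" by linarith
          show ?thesis
            using event_u_if_clique_and_indep[where 'd = 'd, OF _ _ UV(3) K(1) _ K(3) I(1,2) RS(1,2) T few]
              UV(4) K(2) by (auto simp: d_def)
        qed
        then show "of_bool (real (card (cross_pairs K I \<inter> T)) < \<delta> * real (card I)) \<le>
          (of_bool (event_u TYPE('d) n ?k (R \<union> S \<union> T)) :: real)" by auto
      qed (use q in auto)
      finally show "9 / 10 \<le> bern_expect q (cross_pairs (U n) (V n))
        (\<lambda>T. of_bool (event_u TYPE('d) n ?k (R \<union> S \<union> T)))" .
    qed (use q in auto)
    \<comment> \<open>Three stages at 9/10 give 0.729, above the required 1/2.\<close>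
    moreover have "9 / 10 * (9 / 10) * (9 / 10) \<le> bern_expect q (pairs_of (U n)) (\<lambda>R. of_bool (?P R)) *
        bern_expect q (pairs_of (V n)) (\<lambda>S. of_bool (?Q S)) * (9 / 10)"
      using elim(1,2) by (intro mult_mono) (auto simp: q_def U_def)
    ultimately have "prob_Gnp n q (event_u TYPE('d) n ?k) > 1 / 2"
      by (simp add: prob_Gnp_eq_bern_expect all_edges_eq UV(4))
    then have "?k \<le> u_d TYPE('d) n q" by (intro u_d_ge) auto
    then have "real ?k \<le> real (u_d TYPE('d) n q)" by simp
    then have "real j \<le> real (u_d TYPE('d) n q)" by simp
    moreover have "(2 - 2 * \<alpha> - \<epsilon>) * ln (real n) / q \<le> a * ln (real n) / q"
      using a ln0 q by (intro divide_right_mono mult_right_mono) auto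
    ultimately show ?case using j by (simp add: q_def)
  qed
  then show "\<exists>n0. \<forall>n\<ge>n0. (2 - 2 * \<alpha> - \<epsilon>) * ln (real n) / p n \<le> real (u_d TYPE('d) n (p n))"
    by (simp add: eventually_sequentially)
qed

end
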